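(* Let $k\geq 2$, let $0\leq\alpha\leq 1$, and let $c$ be a fixed constant. Let $\mathcal{R}$ be a set of $n$ simple closed Jordan regions in the plane such that $\mathcal{U}_{\mathcal{R}}(m)\leq c\,m^{1+\alpha}$ for $1\leq m\leq n$, and let $H=H(\mathcal{R})$. Then $c_H(k)=O(k n^{\alpha})$ (the implied constant depending only on $c$ and $\alpha$).
   Context: For a finite family $\mathcal{R}$ of regions in $\mathbb{R}^2$ and a point $p$, let $r(p)=\{R\in\mathcal{R}: p\in R\}$. The hypergraph induced by $\mathcal{R}$ is $H(\mathcal{R})=(\mathcal{R},\{r(p)\}_{p\in\mathbb{R}^2})$. Union-complexity: for a family $\mathcal{R}$ of simple closed Jordan regions, it is the number of intersection points of pairs of boundaries of regions in $\mathcal{R}$ that lie on the boundary of the union of the regions of $\mathcal{R}$; by convention the union-complexity of any $n$ regions is taken to be at least $n$. $\mathcal{U}_{\mathcal{R}}(m)$ denotes the maximum union-complexity of any subset of at most $m$ regions of $\mathcal{R}$. $k$-colorful coloring of a hypergraph: a coloring of the vertices such that every hyperedge $e$ contains $\min\{|e|,k\}$ vertices with pairwise distinct colors. $c_H(k)$ is the least number of colors in a $k$-colorful coloring of $H$. *)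

theory Defs
  imports "HOL-Analysis.Analysis"
begin

text \<open>The plane is \<^typ>\<open>complex\<close>, as in the library's treatment of the Jordan curve theorem.\<close>

definition Jordan_region :: "complex set \<Rightarrow> bool" where
  "Jordan_region A \<longleftrightarrow>
     (\<exists>\<gamma>. simple_path \<gamma> \<and> pathfinish \<gamma> = pathstart \<gamma> \<and>
          A = path_image \<gamma> \<union> inside (path_image \<gamma>))"

definition union_vertices :: "complex set set \<Rightarrow> complex set" where
  "union_vertices S =
     {p. p \<in> frontier (\<Union>S) \<and> (\<exists>A\<in>S. \<exists>B\<in>S. A \<noteq> B \<and> p \<in> frontier A \<inter> frontier B)}"

text \<open>
  The union-complexity is \<^term>\<open>\<infinity>\<close> if there are infinitely many intersection points
  (\<^const>\<open>card\<close> would give 0). The maximum with the number of regions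
  is the convention that the union-complexity of \<open>n\<close> regions is at least \<open>n\<close>.
\<close>

definition union_complexity :: "complex set set \<Rightarrow> enat" where
  "union_complexity S =
     max (enat (card S))
         (if finite (union_vertices S) then enat (card (union_vertices S)) else \<infinity>)"

definition max_union_complexity :: "complex set set \<Rightarrow> nat \<Rightarrow> enat" where
  "max_union_complexity R m = Max (union_complexity ` {S. S \<subseteq> R \<and> card S \<le> m})"

text \<open>A hypergraph is a pair of a vertex set and a set of hyperedges.\<close>

type_synonym 'v hypergraph = "'v set \<times> 'v set set"

definition induced_hypergraph :: "complex set set \<Rightarrow> complex set hypergraph" where
  "induced_hypergraph R = (R, range (\<lambda>p. {A \<in> R. p \<in> A}))"

definition colorful_coloring :: "'v hypergraph \<Rightarrow> nat \<Rightarrow> ('v \<Rightarrow> nat) \<Rightarrow> bool" where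
  "colorful_coloring H k \<phi> \<longleftrightarrow>
     (\<forall>e\<in>snd H. \<exists>W\<subseteq>e. card W = min (card e) k \<and> inj_on \<phi> W)"

definition colorful_number :: "'v hypergraph \<Rightarrow> nat \<Rightarrow> nat" where
  "colorful_number H k = (LEAST N. \<exists>\<phi>. colorful_coloring H k \<phi> \<and> card (\<phi> ` fst H) = N)"

end

theory Submission
  imports Defs
begin

text \<open>
  A colouring is built by removing a region of low degree in the graph of \<^emph>\<open>shallow pairs\<close>,
  the pairs of regions with a common point of depth at most \<open>k\<close>, and giving it a colour not used by its
  neighbours: hyperedges of size at most \<open>k\<close> become rainbow, and larger ones keep \<open>k\<close> colours from
  the smaller family. So it suffices that there are \<open>O(k n\<^sup>\<alpha> |S|)\<close> shallow pairs in every
  subfamily \<open>S\<close>. By Clarkson--Shor sampling with probability \<open>1/(2k)\<close> this reduces to pairs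
  \<open>{A, B}\<close> that are exactly the regions of \<open>S\<close> at some point.

  Boundaries may overlap and many regions may meet in one point, so such pairs cannot be charged to
  vertices of the union directly. They are charged to ends of exposed arcs: the arcs into which the
  vertices of the union cut the part of the boundary curves that lies on the frontier of the union of a
  random subfamily. Walk along the boundary of \<open>A\<close> inside \<open>B\<close> until \<open>B\<close> is left (at a vertex of
  the union) or another region is met (at the end of an exposed arc of subfamilies without \<open>B\<close>). If no
  such walk exists, \<open>A \<inter> B\<close> contains a hole of the union of the other regions, and an arc around that
  hole is used.

  The number of exposed arcs is linear in the number of regions and vertices, by planarity. Join the owner
  of each arc with the unique face of the complement on its other side. The arcs of a spanning
  forest of this dual graph are bounded by the number of regions and faces, and bounded faces have at least
  two arcs each. The remaining arcs form a forest, because a cycle would be a Jordan curve separating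
  the owner of one of its arcs from the face at that arc, although the dual forest connects them.
\<close>

section \<open>Jordan regions\<close>

definition bd_loop :: "complex set \<Rightarrow> real \<Rightarrow> complex" where
  "bd_loop A = (SOME \<gamma>. simple_path \<gamma> \<and> pathfinish \<gamma> = pathstart \<gamma> \<and>
                        A = path_image \<gamma> \<union> inside (path_image \<gamma>))"

context
  fixes A :: "complex set"
  assumes A: "Jordan_region A"
begin

lemma bd_loop:
  "simple_path (bd_loop A)" "pathfinish (bd_loop A) = pathstart (bd_loop A)"
  "A = path_image (bd_loop A) \<union> inside (path_image (bd_loop A))"
proof -
  have "\<exists>\<gamma>. simple_path \<gamma> \<and> pathfinish \<gamma> = pathstart \<gamma> \<and>
            A = path_image \<gamma> \<union> inside (path_image \<gamma>)"
    using A by (simp add: Jordan_region_def)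
  from someI_ex[OF this]
  show "simple_path (bd_loop A)" "pathfinish (bd_loop A) = pathstart (bd_loop A)"
    "A = path_image (bd_loop A) \<union> inside (path_image (bd_loop A))"
    by (simp_all only: bd_loop_def)
qed

lemmas bd_loop_Jordan = Jordan_inside_outside[OF bd_loop(1,2)]

lemma Jordan_region_Compl: "- A = outside (path_image (bd_loop A))"
proof -
  have "- A = - path_image (bd_loop A) - inside (path_image (bd_loop A))"
    using bd_loop(3) by blast
  then show ?thesis
    using bd_loop_Jordan by blast
qed

lemma Jordan_region_frontier: "frontier A = path_image (bd_loop A)"
  using bd_loop_Jordan Jordan_region_Compl frontier_complement[of A] by simp

lemma Jordan_region_closed: "closed A"
proof -
  have "open (- A)"
    using bd_loop_Jordan Jordan_region_Compl by simp
  then show ?thesis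
    by (simp add: open_closed)
qed

lemma Jordan_region_interior: "interior A = inside (path_image (bd_loop A))"
proof -
  have "interior A = A - frontier A"
    using interior_subset closure_closed[OF Jordan_region_closed] by (auto simp: frontier_def)
  then show ?thesis
    using bd_loop(3) Jordan_region_frontier inside_no_overlap[of "path_image (bd_loop A)"] by blast
qed

lemma Jordan_region_bounded: "bounded A"
proof -
  have "bounded (path_image (bd_loop A) \<union> inside (path_image (bd_loop A)))"
    using bd_loop_Jordan bounded_simple_path_image[OF bd_loop(1)] by simp
  then show ?thesis
    using bd_loop(3) by simp
qed

lemma Jordan_region_connected_interior: "connected (interior A)"
  using bd_loop_Jordan Jordan_region_interior by simp

lemma Jordan_region_interior_nonempty: "interior A \<noteq> {}"
  using bd_loop_Jordan Jordan_region_interior by simp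

lemma Jordan_region_connected_Compl: "connected (- A)"
  using bd_loop_Jordan Jordan_region_Compl by simp

lemma Jordan_region_closure_interior: "closure (interior A) = A"
proof -
  have "closure (interior A) = inside (path_image (bd_loop A)) \<union> path_image (bd_loop A)"
    using bd_loop_Jordan Jordan_region_interior
      closure_Un_frontier[of "inside (path_image (bd_loop A))"] by simp
  then show ?thesis
    using bd_loop(3) by blast
qed

lemma bd_loop_in_frontier: "0 \<le> t \<Longrightarrow> t \<le> 1 \<Longrightarrow> bd_loop A t \<in> frontier A"
  by (simp add: Jordan_region_frontier path_image_def)

lemma bd_loop_in: "0 \<le> t \<Longrightarrow> t \<le> 1 \<Longrightarrow> bd_loop A t \<in> A"
  using bd_loop_in_frontier frontier_subset_closed[OF Jordan_region_closed] by (meson subsetD)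

lemma bd_loop_continuous: "continuous_on {0..1} (bd_loop A)"
  using bd_loop(1) by (simp add: simple_path_def path_def)

lemma bd_loop_eqD:
  "bd_loop A s = bd_loop A t \<Longrightarrow> 0 \<le> s \<Longrightarrow> s < t \<Longrightarrow> t \<le> 1 \<Longrightarrow> s = 0 \<and> t = 1"
  using bd_loop(1)[unfolded simple_path_def loop_free_def, THEN conjunct2, rule_format, of s t] by simp

lemma bd_loop_finite_params:
  assumes "finite Q"
  shows "finite {t. 0 \<le> t \<and> t \<le> 1 \<and> bd_loop A t \<in> Q}"
proof -
  have inj: "inj_on (bd_loop A) {0<..1}"
  proof (rule inj_onI)
    fix s t assume "s \<in> {0<..1}" "t \<in> {0<..1}" "bd_loop A s = bd_loop A t"
    then show "s = t"
      using bd_loop_eqD[of s t] bd_loop_eqD[of t s] by (cases s t rule: linorder_cases) auto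
  qed
  have "finite ((bd_loop A -` Q) \<inter> {0<..1})"
    by (rule finite_vimage_IntI[OF assms inj])
  moreover have "{t. 0 \<le> t \<and> t \<le> 1 \<and> bd_loop A t \<in> Q} \<subseteq> insert 0 ((bd_loop A -` Q) \<inter> {0<..1})"
    by auto
  ultimately show ?thesis
    using finite_subset by blast
qed

end

lemma simple_loop_local_complement:
  fixes \<gamma> :: "real \<Rightarrow> complex"
  assumes \<gamma>: "simple_path \<gamma>" "pathfinish \<gamma> = pathstart \<gamma>"
    and q: "q \<in> path_image \<gamma>" and N: "open N" "q \<in> N"
  obtains \<beta> where "compact \<beta>" "connected \<beta>" "\<beta> \<subseteq> path_image \<gamma>" "q \<notin> \<beta>" "path_image \<gamma> - \<beta> \<subseteq> N"
proof -
  obtain u where u: "0 \<le> u" "u \<le> 1" "\<gamma> u = q"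
    using q by (auto simp: path_image_def)
  define g where "g = shiftpath u \<gamma>"
  have g: "simple_path g" "path_image g = path_image \<gamma>" "pathstart g = q"
    using simple_path_shiftpath[OF \<gamma> u(1,2)] path_image_shiftpath[OF _ \<gamma>(2), of u]
      pathstart_shiftpath[OF u(2), of \<gamma>] u by (auto simp: g_def)
  have "pathfinish g = q"
    using pathfinish_shiftpath[of u \<gamma>] u \<gamma>(2) by (simp add: g_def)
  with g(3) have g01: "g 0 = q" "g 1 = q"
    by (auto simp: pathstart_def pathfinish_def)
  have cont: "continuous_on {0..1} g"
    using g(1) by (simp add: simple_path_def path_def)
  obtain e where e: "e > 0" "ball q e \<subseteq> N"
    using N openE by blast
  obtain d0 where d0: "d0 > 0" "\<And>t. t \<in> {0..1} \<Longrightarrow> dist t 0 < d0 \<Longrightarrow> dist (g t) (g 0) < e"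
    using cont e(1) unfolding continuous_on_iff by (metis atLeastAtMost_iff order_refl zero_le_one)
  obtain d1 where d1: "d1 > 0" "\<And>t. t \<in> {0..1} \<Longrightarrow> dist t 1 < d1 \<Longrightarrow> dist (g t) (g 1) < e"
    using cont e(1) unfolding continuous_on_iff by (metis atLeastAtMost_iff order_refl zero_le_one)
  define d where "d = min (1/3) (min d0 d1)"
  have d: "0 < d" "d \<le> 1/3" "d \<le> d0" "d \<le> d1"
    using d0 d1 by (auto simp: d_def)
  define \<beta> where "\<beta> = g ` {d..1-d}"
  have "continuous_on {d..1-d} g"
    using cont by (rule continuous_on_subset) (use d in auto)
  then have "compact \<beta>" "connected \<beta>"
    unfolding \<beta>_def by (auto intro: compact_continuous_image connected_continuous_image)
  moreover have "\<beta> \<subseteq> path_image \<gamma>"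
    unfolding g(2)[symmetric] using d by (auto simp: \<beta>_def path_image_def)
  moreover have "q \<notin> \<beta>"
  proof
    assume "q \<in> \<beta>"
    then obtain t where "t \<in> {d..1-d}" "g t = g 0"
      using g01 by (auto simp: \<beta>_def)
    then show False
      using g(1) d unfolding simple_path_def loop_free_def by fastforce
  qed
  moreover have "path_image \<gamma> - \<beta> \<subseteq> N"
  proof
    fix x assume x: "x \<in> path_image \<gamma> - \<beta>"
    then have "x \<in> g ` {0..1}"
      using g(2) by (simp add: path_image_def)
    then obtain t where t: "t \<in> {0..1}" "x = g t" ..
    then have "t \<notin> {d..1-d}"
      using x by (auto simp: \<beta>_def)
    then have "dist t 0 < d0 \<or> dist t 1 < d1"
      using d t by (auto simp: dist_real_def)
    then have "dist x q < e"
      using d0 d1 t g01 by auto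
    then show "x \<in> N"
      using e by (auto simp: dist_commute)
  qed
  ultimately show thesis
    using that by blast
qed

text \<open>Janiszewski's theorem, applied to the boundary curve and to the complement of \<open>N\<close> together
  with the part of the curve far from \<open>q\<close>, replaces the Schoenflies theorem here.\<close>

lemma Jordan_region_one_sided:
  assumes A: "Jordan_region A" and q: "q \<in> frontier A" and N: "open N" "q \<in> N"
  obtains C e where "connected C" "C \<subseteq> N - A" "e > 0" "ball q e - A \<subseteq> C"
proof -
  let ?J = "path_image (bd_loop A)"
  have fr: "frontier A = ?J"
    by (rule Jordan_region_frontier[OF A])
  obtain \<beta> where \<beta>: "compact \<beta>" "connected \<beta>" "\<beta> \<subseteq> ?J" "q \<notin> \<beta>" "?J - \<beta> \<subseteq> N"
    using simple_loop_local_complement[OF bd_loop(1,2)[OF A] q[unfolded fr] N] .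
  have "open (N - \<beta>)"
    using N \<beta>(1) by (simp add: open_Diff compact_imp_closed)
  then obtain e where e: "e > 0" "ball q e \<subseteq> N - \<beta>"
    using N \<beta>(4) openE by blast
  show thesis
  proof (cases "ball q e - A = {}")
    case True
    then show thesis
      using that[of "{}" e] e by auto
  next
    case False
    then obtain a where a: "a \<in> ball q e" "a \<notin> A" by blast
    define C where "C = connected_component_set (N - ?J) a"
    have "ball q e - A \<subseteq> C"
    proof
      fix b assume b: "b \<in> ball q e - A"
      have "closed (- N \<union> \<beta>)"
        using N \<beta>(1) by (simp add: closed_Un closed_Compl compact_imp_closed)
      moreover have "?J \<inter> (- N \<union> \<beta>) = \<beta>"
        using \<beta> by blast
      moreover have "connected_component (- ?J) a b"
        unfolding connected_component_def
        using a b Jordan_region_connected_Compl[OF A] bd_loop(3)[OF A] by blast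
      moreover have "connected_component (- (- N \<union> \<beta>)) a b"
        unfolding connected_component_def
        using a b e by (intro exI[of _ "ball q e"]) auto
      ultimately have "connected_component (- (?J \<union> (- N \<union> \<beta>))) a b"
        using Janiszewski[of ?J "- N \<union> \<beta>" a b] \<beta>(2) compact_simple_path_image[OF bd_loop(1)[OF A]]
        by simp
      moreover have "- (?J \<union> (- N \<union> \<beta>)) = N - ?J"
        using \<beta>(3) by blast
      ultimately show "b \<in> C"
        by (simp add: C_def)
    qed
    moreover have "C \<subseteq> N - A"
    proof -
      have C: "C \<subseteq> N - ?J" "connected C"
        by (auto simp: C_def connected_component_subset)
      have "a \<in> C"
        using \<open>ball q e - A \<subseteq> C\<close> a by blast
      then have "C \<inter> A = {}"
        using connected_Int_frontier[of C A] C a fr by blast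
      with C show ?thesis by blast
    qed
    ultimately show thesis
      using that[of C e] e by (simp add: C_def)
  qed
qed

section \<open>Spanning forests\<close>

definition links :: "('e \<Rightarrow> 'v) \<Rightarrow> ('e \<Rightarrow> 'v) \<Rightarrow> 'e set \<Rightarrow> ('v \<times> 'v) set" where
  "links a b F = (\<Union>e\<in>F. {(a e, b e), (b e, a e)})\<^sup>*"

lemma links_edge:
  "(a e, b e) \<in> links a b F" if "e \<in> F"
  using that by (auto simp: links_def)

lemma links_mono: "F \<subseteq> G \<Longrightarrow> links a b F \<subseteq> links a b G"
  unfolding links_def by (rule rtrancl_mono) auto

lemma links_sym: "(x, y) \<in> links a b F \<Longrightarrow> (y, x) \<in> links a b F"
proof -
  have "sym (\<Union>e\<in>F. {(a e, b e), (b e, a e)})"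
    by (auto simp: sym_def)
  then show "(x, y) \<in> links a b F \<Longrightarrow> (y, x) \<in> links a b F"
    unfolding links_def by (rule symD[OF sym_rtrancl])
qed

lemma links_trans: "(x, y) \<in> links a b F \<Longrightarrow> (y, z) \<in> links a b F \<Longrightarrow> (x, z) \<in> links a b F"
  unfolding links_def by (rule rtrancl_trans)

lemma links_refl: "(x, x) \<in> links a b F"
  by (simp add: links_def)

lemma links_imp:
  assumes "(x, y) \<in> links a b F" "R x x"
    and "\<And>e. e \<in> F \<Longrightarrow> R (a e) (b e)"
    and "\<And>u v. R u v \<Longrightarrow> R v u" "\<And>u v w. R u v \<Longrightarrow> R v w \<Longrightarrow> R u w"
  shows "R x y"
  using assms(1) unfolding links_def
proof (induction rule: rtrancl_induct)
  case base
  then show ?case by (rule assms(2))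
next
  case (step y z)
  then obtain e where e: "e \<in> F" "(y = a e \<and> z = b e) \<or> (y = b e \<and> z = a e)"
    by auto
  then have "R y z"
    using assms(3)[OF e(1)] assms(4)[OF assms(3)[OF e(1)]] by metis
  with step.IH show ?case
    by (rule assms(5))
qed

lemma spanning_forest:
  fixes a b :: "'e \<Rightarrow> 'v"
  assumes "finite E" "finite P" "a ` E \<subseteq> P" "b ` E \<subseteq> P"
  shows "\<exists>F\<subseteq>E. card F \<le> card P \<and> (\<forall>e\<in>E. (a e, b e) \<in> links a b F)"
proof -
  define cls where "cls F = (\<lambda>x. {y\<in>P. (x, y) \<in> links a b F}) ` P" for F
  have cls_card: "card (cls F) \<le> card P" for F
    using assms(2) by (simp add: cls_def card_image_le)
  have "\<exists>F\<subseteq>E. card F + card (cls F) \<le> card P \<and> (\<forall>e\<in>E. (a e, b e) \<in> links a b F)"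
    using assms(1,3,4)
  proof (induction E rule: finite_induct)
    case empty
    then show ?case
      using cls_card[of "{}"] by auto
  next
    case (insert e E)
    then obtain F where F: "F \<subseteq> E" "card F + card (cls F) \<le> card P"
      "\<forall>e\<in>E. (a e, b e) \<in> links a b F" by auto
    show ?case
    proof (cases "(a e, b e) \<in> links a b F")
      case True
      then show ?thesis
        using F by blast
    next
      case False
      define G where "G = insert e F"
      have FG: "links a b F \<subseteq> links a b G"
        by (rule links_mono) (auto simp: G_def)
      have eG: "(a e, b e) \<in> links a b G"
        by (rule links_edge) (simp add: G_def)
      have P: "a e \<in> P" "b e \<in> P"
        using insert.prems by auto
      let ?c = "\<lambda>F x. {y\<in>P. (x, y) \<in> links a b F}"
      have up: "?c G x = {y\<in>P. \<exists>z\<in>?c F x. (z, y) \<in> links a b G}" if "x \<in> P" for x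
      proof (intro equalityI subsetI)
        fix y assume "y \<in> ?c G x"
        then show "y \<in> {y\<in>P. \<exists>z\<in>?c F x. (z, y) \<in> links a b G}"
          using that links_refl[of x a b F] by blast
      next
        fix y assume "y \<in> {y\<in>P. \<exists>z\<in>?c F x. (z, y) \<in> links a b G}"
        then show "y \<in> ?c G x"
          using FG links_trans[of x _ a b G y] by blast
      qed
      define h where "h c = {y\<in>P. \<exists>z\<in>c. (z, y) \<in> links a b G}" for c
      have "cls G = h ` cls F"
        unfolding cls_def image_image h_def using up by (intro image_cong) auto
      moreover have "h (?c F (a e)) = h (?c F (b e))"
      proof -
        have "?c G (a e) = ?c G (b e)"
          using eG links_sym[OF eG] links_trans[of "a e" "b e" a b G] links_trans[of "b e" "a e" a b G]
          by blast
        then show ?thesis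
          using up[OF P(1)] up[OF P(2)] unfolding h_def by simp
      qed
      moreover have "?c F (a e) \<noteq> ?c F (b e)"
      proof -
        have "b e \<in> ?c F (b e)" "b e \<notin> ?c F (a e)"
          using False P(2) links_refl[of "b e" a b F] by simp_all
        then show ?thesis by metis
      qed
      moreover have "?c F (a e) \<in> cls F" "?c F (b e) \<in> cls F"
        using P by (auto simp: cls_def)
      ultimately have "card (cls G) < card (cls F)"
      proof -
        assume h: "cls G = h ` cls F" "h (?c F (a e)) = h (?c F (b e))"
          "?c F (a e) \<noteq> ?c F (b e)" "?c F (a e) \<in> cls F" "?c F (b e) \<in> cls F"
        have fin: "finite (cls F)"
          using assms(2) by (simp add: cls_def)
        have "\<not> inj_on h (cls F)"
          using h(2-5) inj_onD by metis
        then have "card (h ` cls F) \<noteq> card (cls F)"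
          using eq_card_imp_inj_on[OF fin] by blast
        then show ?thesis
          using card_image_le[OF fin, of h] h(1) by simp
      qed
      moreover have "card G = Suc (card F)"
        using F(1) insert.hyps finite_subset by (subst G_def) (auto intro!: card_insert_disjoint)
      ultimately have "card G + card (cls G) \<le> card P"
        using F(2) by linarith
      moreover have "\<forall>e'\<in>insert e E. (a e', b e') \<in> links a b G"
        using F(3) FG eG by blast
      moreover have "G \<subseteq> insert e E"
        using F(1) by (auto simp: G_def)
      ultimately show ?thesis by blast
    qed
  qed
  then show ?thesis
    using add_leD1 by blast
qed

section \<open>Exposed arcs\<close>

lemma connected_subset_closedI:
  fixes K C :: "'a::metric_space set"
  assumes "connected K" "closed C" "K \<inter> C \<noteq> {}"
    and loc: "\<And>q. q \<in> K \<Longrightarrow> q \<in> C \<Longrightarrow> \<exists>e>0. K \<inter> ball q e \<subseteq> C"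
  shows "K \<subseteq> C"
proof -
  have "closedin (top_of_set K) (K \<inter> C)"
    using assms(2) by (simp add: closedin_closed_Int)
  moreover have "openin (top_of_set K) (K \<inter> C)"
    unfolding openin_contains_ball
  proof (intro conjI ballI)
    fix q assume "q \<in> K \<inter> C"
    then obtain e where "e > 0" "K \<inter> ball q e \<subseteq> C"
      using loc by blast
    then show "\<exists>e>0. ball q e \<inter> K \<subseteq> K \<inter> C"
      by (intro exI[of _ e]) blast
  qed simp
  ultimately have "K \<inter> C = {} \<or> K \<inter> C = K"
    using assms(1)[unfolded connected_clopen, rule_format, of "K \<inter> C"] by simp
  then show ?thesis
    using assms(3) by blast
qed

lemma connected_insert_closure:
  fixes S :: "'a::topological_space set"
  shows "connected S \<Longrightarrow> q \<in> closure S \<Longrightarrow> connected (insert q S)"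
  using connected_intermediate_closure[of S "insert q S"] closure_subset[of S]
  by (simp add: subset_insertI)

lemma bounded_open_frontier_Int:
  fixes G W :: "complex set"
  assumes "open G" "connected G" "\<not> bounded G" "open W" "W \<noteq> {}" "W \<subseteq> G" "bounded W" "finite Q"
  obtains q where "q \<in> frontier W" "q \<in> G" "q \<notin> Q"
proof -
  have "connected (G - Q)"
    using assms by (intro connected_open_delete_finite) auto
  moreover have "W - Q \<noteq> {}"
  proof
    assume "W - Q = {}"
    then have "finite W"
      using assms(8) finite_subset[of W Q] by simp
    then show False
      using assms(4,5) finite_imp_not_open[of W] by simp
  qed
  moreover have "\<not> G - Q \<subseteq> W"
  proof
    assume "G - Q \<subseteq> W"
    then have "G \<subseteq> W \<union> Q" by blast
    moreover have "bounded (W \<union> Q)"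
      using assms(7,8) by (simp add: finite_imp_bounded)
    ultimately show False
      using assms(3) bounded_subset by blast
  qed
  ultimately have "(G - Q) \<inter> frontier W \<noteq> {}"
    using connected_Int_frontier[of "G - Q" W] assms(6) by blast
  then show thesis
    using that by blast
qed

definition marks :: "complex set set \<Rightarrow> complex set" where
  "marks T = union_vertices T \<union> (\<Union>A\<in>T. {bd_loop A 0, bd_loop A (1/2)})"

definition exposed_arcs :: "complex set set \<Rightarrow> (complex set \<times> real \<times> real) set" where
  "exposed_arcs T = {(A, s, t). A \<in> T \<and> 0 \<le> s \<and> s < t \<and> t \<le> 1 \<and>
      bd_loop A s \<in> marks T \<and> bd_loop A t \<in> marks T \<and>
      bd_loop A ` {s<..<t} \<subseteq> frontier (\<Union>T) - marks T}"

definition arc_interior :: "complex set \<times> real \<times> real \<Rightarrow> complex set" where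
  "arc_interior e = (case e of (A, s, t) \<Rightarrow> bd_loop A ` {s<..<t})"

definition arc_closed :: "complex set \<times> real \<times> real \<Rightarrow> complex set" where
  "arc_closed e = (case e of (A, s, t) \<Rightarrow> bd_loop A ` {s..t})"

definition arc_start :: "complex set \<times> real \<times> real \<Rightarrow> complex" where
  "arc_start e = (case e of (A, s, t) \<Rightarrow> bd_loop A s)"

definition arc_end :: "complex set \<times> real \<times> real \<Rightarrow> complex" where
  "arc_end e = (case e of (A, s, t) \<Rightarrow> bd_loop A t)"

locale region_family =
  fixes T :: "complex set set"
  assumes finite_T: "finite T"
    and Jordan_T: "A \<in> T \<Longrightarrow> Jordan_region A"
    and finite_vertices: "finite (union_vertices T)"
begin

lemma closed_Union_T: "closed (\<Union>T)"
  using closed_Union[OF finite_T] Jordan_region_closed[OF Jordan_T] by metis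

lemma bounded_Union_T: "bounded (\<Union>T)"
  using bounded_Union[OF finite_T] Jordan_region_bounded[OF Jordan_T] by metis

lemma finite_marks: "finite (marks T)"
  using finite_T finite_vertices by (simp add: marks_def)

lemma card_marks: "card (marks T) \<le> card (union_vertices T) + 2 * card T"
proof -
  have "card (\<Union>A\<in>T. {bd_loop A 0, bd_loop A (1/2)}) \<le> (\<Sum>A\<in>T. card {bd_loop A 0, bd_loop A (1/2)})"
    using finite_T by (rule card_UN_le)
  also have "\<dots> \<le> (\<Sum>A\<in>T. 2)"
    by (intro sum_mono) (simp add: card_insert_le_m1)
  finally have "card (\<Union>A\<in>T. {bd_loop A 0, bd_loop A (1/2)}) \<le> 2 * card T"
    by simp
  then show ?thesis
    using card_Un_le[of "union_vertices T" "\<Union>A\<in>T. {bd_loop A 0, bd_loop A (1/2)}"]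
    unfolding marks_def by linarith
qed

lemma frontier_Union_region:
  assumes "A \<in> T" "q \<in> A" "q \<in> frontier (\<Union>T)"
  shows "q \<in> frontier A"
proof -
  have "interior A \<subseteq> interior (\<Union>T)"
    using assms(1) by (intro interior_mono) blast
  then show ?thesis
    using assms closure_subset[of A] by (auto simp: frontier_def)
qed

lemma only_region:
  assumes "q \<in> frontier (\<Union>T)" "q \<notin> union_vertices T" "A \<in> T" "q \<in> A" "B \<in> T" "q \<in> B"
  shows "A = B"
proof (rule ccontr)
  assume "A \<noteq> B"
  moreover have "q \<in> frontier A \<inter> frontier B"
    using frontier_Union_region[OF assms(3,4,1)] frontier_Union_region[OF assms(5,6,1)] by simp
  ultimately have "q \<in> union_vertices T"
    unfolding union_vertices_def using assms(1,3,5) by blast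
  with assms(2) show False ..
qed

lemma frontier_Union_obtain_region:
  assumes "q \<in> frontier (\<Union>T)"
  obtains A where "A \<in> T" "q \<in> A" "q \<in> frontier A"
proof -
  have "q \<in> \<Union>T"
    using assms frontier_subset_closed[OF closed_Union_T] by blast
  then show thesis
    using that frontier_Union_region[OF _ _ assms] by blast
qed

lemma ball_avoiding_others:
  assumes "\<And>B. B \<in> T \<Longrightarrow> B \<noteq> A \<Longrightarrow> q \<notin> B"
  obtains e where "e > 0" "ball q e \<inter> \<Union>(T - {A}) = {}"
proof -
  have "closed (\<Union>(T - {A}))"
    using finite_T Jordan_T Jordan_region_closed by blast
  then have "open (- \<Union>(T - {A}))"
    by (rule open_Compl)
  moreover have "q \<in> - \<Union>(T - {A})"
    using assms by blast
  ultimately show thesis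
    using that by (meson disjoint_eq_subset_Compl openE)
qed

lemma region_frontier_in_frontier_Union:
  assumes "A \<in> T" "q \<in> frontier A" "\<And>B. B \<in> T \<Longrightarrow> B \<noteq> A \<Longrightarrow> q \<notin> B"
  shows "q \<in> frontier (\<Union>T)"
proof -
  have "q \<in> A"
    using assms(1,2) Jordan_T Jordan_region_closed frontier_subset_closed by blast
  obtain e where e: "e > 0" "ball q e \<inter> \<Union>(T - {A}) = {}"
    using ball_avoiding_others assms(3) by blast
  have "q \<notin> interior (\<Union>T)"
  proof
    assume "q \<in> interior (\<Union>T)"
    then have "q \<in> interior (\<Union>T) \<inter> ball q e" "interior (\<Union>T) \<inter> ball q e \<subseteq> A"
      using e interior_subset[of "\<Union>T"] by (simp, blast)
    then have "q \<in> interior A"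
      by (meson interior_maximal open_Int open_ball open_interior subsetD)
    then show False
      using assms(2) by (simp add: frontier_def)
  qed
  then show ?thesis
    using \<open>q \<in> A\<close> assms(1) closure_subset[of "\<Union>T"] by (auto simp: frontier_def)
qed

lemma connected_in_frontier_Union:
  assumes "A \<in> T" "connected K" "K \<subseteq> frontier A" "K \<inter> union_vertices T = {}"
    "K \<inter> frontier (\<Union>T) \<noteq> {}"
  shows "K \<subseteq> frontier (\<Union>T)"
proof (rule connected_subset_closedI[OF assms(2) frontier_closed assms(5)])
  fix q assume q: "q \<in> K" "q \<in> frontier (\<Union>T)"
  then have qA: "q \<in> A" "q \<notin> union_vertices T"
    using assms Jordan_T Jordan_region_closed frontier_subset_closed by blast+
  have "\<And>B. B \<in> T \<Longrightarrow> B \<noteq> A \<Longrightarrow> q \<notin> B"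
    using only_region[OF q(2) qA(2) assms(1) qA(1)] by blast
  then obtain e where e: "e > 0" "ball q e \<inter> \<Union>(T - {A}) = {}"
    using ball_avoiding_others by blast
  have "x \<in> frontier (\<Union>T)" if "x \<in> K \<inter> ball q e" for x
    using that e assms(1,3) by (intro region_frontier_in_frontier_Union[of A]) auto
  with e(1) show "\<exists>e>0. K \<inter> ball q e \<subseteq> frontier (\<Union>T)" by blast
qed

lemma face_at_point:
  assumes "q \<in> frontier (\<Union>T)" "q \<notin> union_vertices T"
  obtains W e where "W \<in> components (- \<Union>T)" "e > 0" "ball q e - \<Union>T \<subseteq> W"
proof -
  obtain A where A: "A \<in> T" "q \<in> A" "q \<in> frontier A"
    using frontier_Union_obtain_region assms(1) by blast
  have "\<And>B. B \<in> T \<Longrightarrow> B \<noteq> A \<Longrightarrow> q \<notin> B"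
    using only_region[OF assms A(1,2)] by blast
  then obtain d where d: "d > 0" "ball q d \<inter> \<Union>(T - {A}) = {}"
    using ball_avoiding_others by blast
  obtain C e where C: "connected C" "C \<subseteq> ball q d - A" "e > 0" "ball q e - A \<subseteq> C"
    using Jordan_region_one_sided[OF Jordan_T[OF A(1)] A(3), of "ball q d"] d(1) by auto
  have sub: "C \<subseteq> - \<Union>T"
    using C(2) d(2) by blast
  have "q \<in> closure (- \<Union>T)"
    using assms(1) by (simp add: frontier_closures)
  then obtain y where y: "y \<in> - \<Union>T" "y \<in> ball q e"
    using C(3) by (auto simp: closure_approachable dist_commute)
  then have "y \<in> C"
    using C(4) A(1) by blast
  obtain W where W: "W \<in> components (- \<Union>T)" "C \<subseteq> W"
    using exists_component_superset[OF sub _ C(1)] y by blast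
  have "ball q e - \<Union>T \<subseteq> W"
    using C(4) W(2) A(1) by blast
  then show thesis
    using that W C(3) by blast
qed

lemma face_unique:
  assumes "q \<in> frontier (\<Union>T)" "q \<notin> union_vertices T"
    "W \<in> components (- \<Union>T)" "q \<in> closure W"
    "W' \<in> components (- \<Union>T)" "q \<in> closure W'"
  shows "W = W'"
proof -
  obtain W0 e where W0: "W0 \<in> components (- \<Union>T)" "e > 0" "ball q e - \<Union>T \<subseteq> W0"
    using face_at_point assms(1,2) by blast
  have "V = W0" if V: "V \<in> components (- \<Union>T)" "q \<in> closure V" for V
  proof -
    obtain y where "y \<in> V" "y \<in> ball q e"
      using V(2) W0(2) by (auto simp: closure_approachable dist_commute)
    moreover have "V \<subseteq> - \<Union>T"
      using V(1) in_components_subset by blast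
    ultimately have "V \<inter> W0 \<noteq> {}"
      using W0(3) by blast
    then show ?thesis
      using components_eq[OF V(1) W0(1)] by blast
  qed
  then show ?thesis
    using assms by blast
qed

lemma connected_in_closure_face:
  assumes "connected K" "K \<subseteq> frontier (\<Union>T)" "K \<inter> union_vertices T = {}"
    "W \<in> components (- \<Union>T)" "K \<inter> closure W \<noteq> {}"
  shows "K \<subseteq> closure W"
proof (rule connected_subset_closedI[OF assms(1) closed_closure assms(5)])
  fix q assume q: "q \<in> K" "q \<in> closure W"
  then have q': "q \<in> frontier (\<Union>T)" "q \<notin> union_vertices T"
    using assms by blast+
  obtain W0 e where W0: "W0 \<in> components (- \<Union>T)" "e > 0" "ball q e - \<Union>T \<subseteq> W0"
    using face_at_point q' by blast
  have cl: "x \<in> closure W0" if x: "x \<in> K" "x \<in> ball q e" for x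
  proof -
    have "x \<in> closure (- \<Union>T)"
      using x(1) assms(2) by (auto simp: frontier_closures)
    then have "x \<in> closure (ball q e \<inter> (- \<Union>T))"
      using x(2) open_Int_closure_subset[of "ball q e" "- \<Union>T"] by blast
    moreover have "ball q e \<inter> (- \<Union>T) \<subseteq> W0"
      using W0(3) by blast
    ultimately show ?thesis
      using closure_mono by blast
  qed
  have "W0 = W"
    using face_unique[OF q' W0(1) _ assms(4) q(2)] cl[OF q(1)] W0(2) by simp
  with cl W0(2) show "\<exists>e>0. K \<inter> ball q e \<subseteq> closure W" by blast
qed

lemma exposed_arc_through:
  assumes "A \<in> T" "0 \<le> u" "u \<le> 1" "bd_loop A u \<in> frontier (\<Union>T)" "bd_loop A u \<notin> marks T"
  obtains s t where "(A, s, t) \<in> exposed_arcs T" "s < u" "u < t"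
proof -
  let ?M = "{t. 0 \<le> t \<and> t \<le> 1 \<and> bd_loop A t \<in> marks T}"
  have fin: "finite ?M"
    using bd_loop_finite_params[OF Jordan_T[OF assms(1)] finite_marks] .
  have "bd_loop A 0 \<in> marks T" "bd_loop A 1 \<in> marks T"
    using assms(1) bd_loop(2)[OF Jordan_T[OF assms(1)]]
    by (auto simp: marks_def pathstart_def pathfinish_def)
  then have M: "0 \<in> ?M" "1 \<in> ?M" by auto
  define s where "s = Max {t\<in>?M. t \<le> u}"
  define t where "t = Min {t\<in>?M. u \<le> t}"
  have "{t\<in>?M. t \<le> u} \<noteq> {}" "{t\<in>?M. u \<le> t} \<noteq> {}"
    using M assms(2,3) by blast+
  then have s: "s \<in> {t\<in>?M. t \<le> u}" and t: "t \<in> {t\<in>?M. u \<le> t}"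
    unfolding s_def t_def
    by (intro Max_in Min_in finite_subset[OF _ fin]; blast)+
  have su: "s < u" "u < t"
    using s t assms(5) by (auto simp: order_less_le)
  have none: "bd_loop A v \<notin> marks T" if "s < v" "v < t" for v
  proof
    assume v: "bd_loop A v \<in> marks T"
    have "v \<in> ?M"
      using v that s t by auto
    then have "v \<le> s \<or> t \<le> v"
    proof (cases "v \<le> u")
      case True
      then show ?thesis
        unfolding s_def using \<open>v \<in> ?M\<close> by (intro disjI1 Max_ge finite_subset[OF _ fin]) auto
    next
      case False
      then show ?thesis
        unfolding t_def using \<open>v \<in> ?M\<close> by (intro disjI2 Min_le finite_subset[OF _ fin]) auto
    qed
    with that show False by auto
  qed
  have "bd_loop A ` {s<..<t} \<subseteq> frontier (\<Union>T)"
  proof (rule connected_in_frontier_Union[OF assms(1)])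
    have "continuous_on {s<..<t} (bd_loop A)"
      using bd_loop_continuous[OF Jordan_T[OF assms(1)]] by (rule continuous_on_subset) (use s t in auto)
    then show "connected (bd_loop A ` {s<..<t})"
      by (rule connected_continuous_image) simp
    show "bd_loop A ` {s<..<t} \<subseteq> frontier A"
      using bd_loop_in_frontier[OF Jordan_T[OF assms(1)]] s t by auto
    show "bd_loop A ` {s<..<t} \<inter> union_vertices T = {}"
      using none by (auto simp: marks_def)
    show "bd_loop A ` {s<..<t} \<inter> frontier (\<Union>T) \<noteq> {}"
    proof -
      have "bd_loop A u \<in> bd_loop A ` {s<..<t}"
        using su by (intro imageI) simp
      then show ?thesis
        using assms(4) by blast
    qed
  qed
  with none have "(A, s, t) \<in> exposed_arcs T"
    using assms(1) s t su by (auto simp: exposed_arcs_def)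
  then show thesis
    using that su by blast
qed

definition arc_face :: "complex set \<times> real \<times> real \<Rightarrow> complex set" where
  "arc_face e = (SOME W. W \<in> components (- \<Union>T) \<and> arc_interior e \<subseteq> closure W)"

lemma finite_exposed_arcs: "finite (exposed_arcs T)"
proof -
  let ?M = "\<lambda>A. {t. 0 \<le> t \<and> t \<le> 1 \<and> bd_loop A t \<in> marks T}"
  have "exposed_arcs T \<subseteq> Sigma T (\<lambda>A. ?M A \<times> ?M A)"
    by (auto simp: exposed_arcs_def)
  moreover have "finite (Sigma T (\<lambda>A. ?M A \<times> ?M A))"
    using finite_T bd_loop_finite_params[OF Jordan_T finite_marks] by auto
  ultimately show ?thesis
    using finite_subset by blast
qed

lemma exposed_arcD:
  assumes "e \<in> exposed_arcs T"
  shows "fst e \<in> T" "arc_interior e \<noteq> {}" "connected (arc_interior e)"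
    "arc_interior e \<subseteq> frontier (\<Union>T) - marks T" "arc_interior e \<subseteq> frontier (fst e)"
    "arc_closed e = arc_interior e \<union> {arc_start e, arc_end e}"
    "arc_start e \<in> marks T" "arc_end e \<in> marks T"
    "arc_closed e \<subseteq> frontier (\<Union>T)"
    "\<exists>g. arc g \<and> path_image g = arc_closed e \<and> pathstart g = arc_start e \<and> pathfinish g = arc_end e"
proof -
  obtain A s t where e: "e = (A, s, t)" by (cases e)
  have A: "A \<in> T" "0 \<le> s" "s < t" "t \<le> 1" "bd_loop A s \<in> marks T" "bd_loop A t \<in> marks T"
    "bd_loop A ` {s<..<t} \<subseteq> frontier (\<Union>T) - marks T"
    using assms by (auto simp: e exposed_arcs_def)
  note J = Jordan_T[OF A(1)]
  have cont: "continuous_on {s..t} (bd_loop A)"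
    using bd_loop_continuous[OF J] by (rule continuous_on_subset) (use A in auto)
  show "fst e \<in> T" "arc_interior e \<noteq> {}" "arc_interior e \<subseteq> frontier (\<Union>T) - marks T"
    "arc_start e \<in> marks T" "arc_end e \<in> marks T"
    using A by (auto simp: e arc_interior_def arc_start_def arc_end_def)
  have "continuous_on {s<..<t} (bd_loop A)"
    using cont by (rule continuous_on_subset) auto
  then show "connected (arc_interior e)"
    unfolding e arc_interior_def by (auto intro: connected_continuous_image)
  show "arc_interior e \<subseteq> frontier (fst e)"
    using bd_loop_in_frontier[OF J] A by (auto simp: e arc_interior_def)
  have "{s..t} = {s<..<t} \<union> {s, t}"
    using A(3) by auto
  then show "arc_closed e = arc_interior e \<union> {arc_start e, arc_end e}"
    by (simp add: e arc_interior_def arc_start_def arc_end_def arc_closed_def image_Un)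
  have "bd_loop A ` closure {s<..<t} \<subseteq> frontier (\<Union>T)"
    using A(3,7) cont by (intro image_closure_subset) auto
  then show "arc_closed e \<subseteq> frontier (\<Union>T)"
    using A(3) by (simp add: e arc_closed_def)
  have "bd_loop A s \<noteq> bd_loop A t"
  proof
    assume "bd_loop A s = bd_loop A t"
    then have "s = 0 \<and> t = 1"
      using bd_loop_eqD[OF J] A by blast
    then have "bd_loop A (1/2) \<in> bd_loop A ` {s<..<t}"
      by (intro imageI) simp
    then have "bd_loop A (1/2) \<notin> marks T"
      using A(7) by blast
    then show False
      using A(1) by (auto simp: marks_def)
  qed
  then have "arc (subpath s t (bd_loop A))"
    using A by (intro arc_simple_path_subpath[OF bd_loop(1)[OF J]]) auto
  then show "\<exists>g. arc g \<and> path_image g = arc_closed e \<and> pathstart g = arc_start e \<and> pathfinish g = arc_end e"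
    using A by (intro exI[of _ "subpath s t (bd_loop A)"])
      (auto simp: e path_image_subpath arc_closed_def arc_start_def arc_end_def)
qed

lemma exposed_arcs_disjoint:
  assumes "e \<in> exposed_arcs T" "e' \<in> exposed_arcs T" "arc_interior e \<inter> arc_closed e' \<noteq> {}"
  shows "e = e'"
proof -
  obtain q where q: "q \<in> arc_interior e" "q \<in> arc_closed e'"
    using assms(3) by blast
  have q': "q \<notin> marks T" "q \<in> frontier (\<Union>T)"
    using q(1) exposed_arcD(4)[OF assms(1)] by blast+
  then have "q \<in> arc_interior e'"
    using q(2) exposed_arcD(6-8)[OF assms(2)] by blast
  obtain A s t where e: "e = (A, s, t)" by (cases e)
  obtain A' s' t' where e': "e' = (A', s', t')" by (cases e')
  obtain u u' where u: "s < u" "u < t" "q = bd_loop A u" "s' < u'" "u' < t'" "q = bd_loop A' u'"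
    using q(1) \<open>q \<in> arc_interior e'\<close> by (auto simp: e e' arc_interior_def)
  have A: "A \<in> T" "0 \<le> s" "t \<le> 1" "A' \<in> T" "0 \<le> s'" "t' \<le> 1"
    "\<And>v. s < v \<Longrightarrow> v < t \<Longrightarrow> bd_loop A v \<notin> marks T" "bd_loop A s \<in> marks T" "bd_loop A t \<in> marks T"
    "\<And>v. s' < v \<Longrightarrow> v < t' \<Longrightarrow> bd_loop A' v \<notin> marks T" "bd_loop A' s' \<in> marks T" "bd_loop A' t' \<in> marks T"
    using assms(1,2) unfolding e e' exposed_arcs_def by (auto simp: image_subset_iff)
  have "q \<in> A" "q \<in> A'"
    using u A bd_loop_in[OF Jordan_T[OF A(1)], of u] bd_loop_in[OF Jordan_T[OF A(4)], of u']
    by simp_all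
  then have AA: "A' = A"
    using only_region[OF q'(2) _ A(4) _ A(1)] q'(1) by (auto simp: marks_def)
  have "u' = u"
    using bd_loop_eqD[OF Jordan_T[OF A(1)], of u u'] bd_loop_eqD[OF Jordan_T[OF A(1)], of u' u] u A AA
    by (cases u u' rule: linorder_cases) auto
  have "s = s'"
    using A(7)[of s'] A(10)[of s] A(8,11) u \<open>u' = u\<close> AA by (cases s s' rule: linorder_cases) auto
  moreover have "t = t'"
    using A(7)[of t'] A(10)[of t] A(9,12) u \<open>u' = u\<close> AA by (cases t t' rule: linorder_cases) auto
  ultimately show ?thesis
    by (simp add: e e' AA)
qed

lemma arc_face:
  assumes "e \<in> exposed_arcs T"
  shows "arc_face e \<in> components (- \<Union>T)" "arc_interior e \<subseteq> closure (arc_face e)"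
proof -
  obtain q where q: "q \<in> arc_interior e"
    using exposed_arcD(2)[OF assms] by blast
  have sub: "arc_interior e \<subseteq> frontier (\<Union>T)" "arc_interior e \<inter> union_vertices T = {}"
    using exposed_arcD(4)[OF assms] by (auto simp: marks_def)
  obtain W d where W: "W \<in> components (- \<Union>T)" "d > 0" "ball q d - \<Union>T \<subseteq> W"
    using face_at_point[of q] q sub by blast
  have "q \<in> closure (- \<Union>T)"
    using q sub by (auto simp: frontier_closures)
  then have "q \<in> closure (ball q d \<inter> - \<Union>T)"
    using W(2) open_Int_closure_subset[of "ball q d" "- \<Union>T"] by auto
  moreover have "ball q d \<inter> - \<Union>T \<subseteq> W"
    using W(3) by blast
  ultimately have "q \<in> closure W"
    using closure_mono by blast
  then have "arc_interior e \<subseteq> closure W"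
    using connected_in_closure_face[OF exposed_arcD(3)[OF assms] sub W(1)] q by blast
  then have "\<exists>W. W \<in> components (- \<Union>T) \<and> arc_interior e \<subseteq> closure W"
    using W(1) by blast
  from someI_ex[OF this]
  show "arc_face e \<in> components (- \<Union>T)" "arc_interior e \<subseteq> closure (arc_face e)"
    unfolding arc_face_def by blast+
qed

lemma arc_face_unique:
  assumes "e \<in> exposed_arcs T" "W \<in> components (- \<Union>T)" "q \<in> arc_interior e" "q \<in> closure W"
  shows "arc_face e = W"
proof (rule face_unique[OF _ _ arc_face(1)[OF assms(1)] _ assms(2,4)])
  have "q \<in> frontier (\<Union>T) - marks T"
    using exposed_arcD(4)[OF assms(1)] assms(3) by blast
  then show "q \<in> frontier (\<Union>T)" "q \<notin> union_vertices T"
    by (simp_all add: marks_def)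
  show "q \<in> closure (arc_face e)"
    using arc_face(2)[OF assms(1)] assms(3) by blast
qed

lemma bounded_face_arc:
  assumes W: "W \<in> components (- \<Union>T)" "bounded W"
    and G: "open G" "connected G" "\<not> bounded G" "W \<subseteq> G"
  obtains e where "e \<in> exposed_arcs T" "arc_face e = W" "frontier (fst e) \<inter> G \<noteq> {}"
proof -
  have "open W"
    using W(1) closed_Union_T open_components by blast
  moreover have "W \<noteq> {}"
    using W(1) in_components_nonempty by blast
  ultimately obtain q where q: "q \<in> frontier W" "q \<in> G" "q \<notin> marks T"
    using bounded_open_frontier_Int[OF G(1-3) _ _ G(4) W(2) finite_marks] by blast
  have qX: "q \<in> frontier (\<Union>T)"
    using q(1) frontier_of_components_subset[OF W(1)] by (auto simp: frontier_complement)
  then obtain A where A: "A \<in> T" "q \<in> A" "q \<in> frontier A"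
    using frontier_Union_obtain_region by blast
  then obtain u where u: "0 \<le> u" "u \<le> 1" "q = bd_loop A u"
    using Jordan_region_frontier[OF Jordan_T[OF A(1)]] by (auto simp: path_image_def)
  obtain s t where st: "(A, s, t) \<in> exposed_arcs T" "s < u" "u < t"
    using exposed_arc_through[OF A(1) u(1,2)] q(3) qX u(3) by blast
  have "q \<in> arc_interior (A, s, t)"
    using st u by (auto simp: arc_interior_def)
  then have "arc_face (A, s, t) = W"
    using arc_face_unique[OF st(1) W(1)] q(1) by (simp add: frontier_def)
  with st(1) A(3) q(2) show thesis
    using that[of "(A, s, t)"] by auto
qed

lemma card_faces: "2 * card (arc_face ` exposed_arcs T) \<le> card (exposed_arcs T) + 2"
proof -
  let ?E = "exposed_arcs T"
  let ?F = "arc_face ` ?E"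
  let ?B = "{W \<in> ?F. bounded W}"
  let ?U = "{W \<in> ?F. \<not> bounded W}"
  have fin: "finite ?E" "finite ?F"
    using finite_exposed_arcs by auto
  have two: "2 \<le> card {e \<in> ?E. arc_face e = W}" if W: "W \<in> ?B" for W
  proof -
    have W': "W \<in> components (- \<Union>T)" "bounded W"
      using W arc_face by auto
    obtain e where e: "e \<in> ?E" "arc_face e = W"
      using W by blast
    note J = Jordan_T[OF exposed_arcD(1)[OF e(1)]]
    have "W \<subseteq> - fst e"
      using in_components_subset[OF W'(1)] exposed_arcD(1)[OF e(1)] by blast
    then obtain e' where e': "e' \<in> ?E" "arc_face e' = W" "frontier (fst e') \<inter> - fst e \<noteq> {}"
      using bounded_face_arc[OF W', of "- fst e"] Jordan_region_closed[OF J]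
        Jordan_region_connected_Compl[OF J] Jordan_region_bounded[OF J]
      by (metis cobounded_imp_unbounded double_compl open_Compl)
    have "e' \<noteq> e"
      using e'(3) frontier_subset_closed[OF Jordan_region_closed[OF J]] by blast
    then have "card {e, e'} = 2"
      by simp
    moreover have "card {e, e'} \<le> card {e \<in> ?E. arc_face e = W}"
      using e e' fin by (intro card_mono) auto
    ultimately show ?thesis by linarith
  qed
  have "card ?U \<le> 1"
  proof -
    have "W = W'" if "W \<in> ?U" "W' \<in> ?U" for W W'
      using cobounded_unique_unbounded_components[of "- \<Union>T" W' W] that arc_face(1) bounded_Union_T
      by auto
    then show ?thesis
      using fin by (intro card_le_Suc0_iff_eq[THEN iffD2, folded One_nat_def]) auto
  qed
  have "2 * card ?B = (\<Sum>W\<in>?B. 2)"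
    by simp
  also have "\<dots> \<le> (\<Sum>W\<in>?B. card {e \<in> ?E. arc_face e = W})"
    using two by (intro sum_mono) auto
  also have "\<dots> \<le> (\<Sum>W\<in>?F. card {e \<in> ?E. arc_face e = W})"
    using fin by (intro sum_mono2) auto
  also have "\<dots> = card ?E"
    using sum.image_gen[OF fin(1), of "\<lambda>_. 1::nat" arc_face] by simp
  finally have "2 * card ?B \<le> card ?E" .
  moreover have "?F = ?B \<union> ?U" by blast
  then have "card ?F \<le> card ?B + card ?U"
    using card_Un_le[of ?B ?U] by simp
  ultimately show ?thesis
    using \<open>card ?U \<le> 1\<close> by linarith
qed

text \<open>Near an interior point of an exposed arc \<open>e\<close> every side of a curve through \<open>e\<close> meets the owner
  of \<open>e\<close> or the face at \<open>e\<close>; so a closed curve in the frontier containing \<open>e\<close> separates the two.\<close>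

lemma loop_separates_arc_sides:
  assumes e: "e \<in> exposed_arcs T" and q: "q \<in> arc_interior e"
    and g: "simple_path g" "pathfinish g = pathstart g" "q \<in> path_image g"
    and C: "connected C" "C \<inter> path_image g = {}" "interior (fst e) \<subseteq> C" "arc_face e \<subseteq> C"
  shows False
proof -
  let ?J = "path_image g"
  note J = Jordan_inside_outside[OF g(1,2)]
  have q': "q \<in> frontier (\<Union>T)" "q \<notin> union_vertices T"
    using exposed_arcD(4)[OF e] q by (auto simp: marks_def)
  have qA: "q \<in> fst e" "fst e \<in> T"
    using exposed_arcD(1,5)[OF e] q Jordan_T Jordan_region_closed frontier_subset_closed by blast+
  obtain W d where W: "W \<in> components (- \<Union>T)" "d > 0" "ball q d - \<Union>T \<subseteq> W"
    using face_at_point[OF q'] by blast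
  have "W = arc_face e"
  proof -
    have "q \<in> closure (- \<Union>T)"
      using q' by (auto simp: frontier_closures)
    then have "q \<in> closure (ball q d \<inter> - \<Union>T)"
      using W(2) open_Int_closure_subset[of "ball q d" "- \<Union>T"] by auto
    moreover have "ball q d \<inter> - \<Union>T \<subseteq> W"
      using W(3) by blast
    ultimately have "q \<in> closure W"
      using closure_mono by blast
    then show ?thesis
      using arc_face_unique[OF e W(1) q] by simp
  qed
  have "\<And>B. B \<in> T \<Longrightarrow> B \<noteq> fst e \<Longrightarrow> q \<notin> B"
    using only_region[OF q' qA(2,1)] by blast
  then obtain d' where d': "d' > 0" "ball q d' \<inter> \<Union>(T - {fst e}) = {}"
    using ball_avoiding_others by blast
  have meets: "G \<inter> C \<noteq> {}" if G: "open G" "q \<in> frontier G" for G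
  proof -
    have "q \<in> closure G"
      using G(2) by (simp add: frontier_def)
    moreover have "min d d' > 0"
      using W(2) d'(1) by simp
    ultimately obtain y where y: "y \<in> G" "dist y q < min d d'"
      by (meson closure_approachable)
    show ?thesis
    proof (cases "y \<in> \<Union>T")
      case False
      then have "y \<in> W"
        using W(3) y by (auto simp: dist_commute)
      then show ?thesis
        using y(1) C(4) \<open>W = arc_face e\<close> by blast
    next
      case True
      then have "y \<in> fst e"
        using d' y by (auto simp: dist_commute)
      then have "y \<in> closure (interior (fst e))"
        using Jordan_region_closure_interior[OF Jordan_T[OF qA(2)]] by simp
      then have "G \<inter> interior (fst e) \<noteq> {}"
        using G(1) y(1) by (metis disjoint_iff open_Int_closure_eq_empty)
      then show ?thesis
        using C(3) by blast
    qed
  qed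
  have "inside ?J \<inter> C \<noteq> {}" "outside ?J \<inter> C \<noteq> {}"
    using meets J g(3) by simp_all
  then have "C \<inter> frontier (inside ?J) \<noteq> {}"
    using connected_Int_frontier[OF C(1), of "inside ?J"] J by blast
  then show False
    using J C(2) by simp
qed

lemma card_exposed_arcs_aux:
  "card (exposed_arcs T) \<le> card T + card (arc_face ` exposed_arcs T) + card (marks T)"
proof -
  let ?E = "exposed_arcs T"
  define own where "own e = (Inl (fst e) :: complex set + complex set)" for e :: "complex set \<times> real \<times> real"
  define fac where "fac e = (Inr (arc_face e) :: complex set + complex set)" for e
  have fin: "finite ?E"
    by (rule finite_exposed_arcs)
  have nodes: "own ` ?E \<subseteq> T <+> arc_face ` ?E" "fac ` ?E \<subseteq> T <+> arc_face ` ?E"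
    using exposed_arcD(1) by (auto simp: own_def fac_def)
  have finN: "finite (T <+> arc_face ` ?E)"
    using finite_T fin by simp
  obtain E1 where E1: "E1 \<subseteq> ?E" "card E1 \<le> card (T <+> arc_face ` ?E)"
    "\<forall>e\<in>?E. (own e, fac e) \<in> links own fac E1"
    using spanning_forest[OF fin finN nodes] by metis
  define E2 where "E2 = ?E - E1"
  define P where "P = marks T \<inter> frontier (\<Union>T)"
  have finP: "finite P"
    using finite_marks by (simp add: P_def)
  have E2: "finite E2" "arc_start ` E2 \<subseteq> P" "arc_end ` E2 \<subseteq> P"
    using fin exposed_arcD(6-9) by (auto simp: E2_def P_def)
  obtain E3 where E3: "E3 \<subseteq> E2" "card E3 \<le> card P"
    "\<forall>e\<in>E2. (arc_start e, arc_end e) \<in> links arc_start arc_end E3"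
    using spanning_forest[OF E2(1) finP E2(2,3)] by metis
  have "E2 \<subseteq> E3"
  proof (rule ccontr)
    assume "\<not> E2 \<subseteq> E3"
    then obtain e where e: "e \<in> E2" "e \<notin> E3" by blast
    then have eE: "e \<in> ?E" "e \<notin> E1"
      by (auto simp: E2_def)
    define K where "K = P \<union> \<Union>(arc_closed ` E3)"
    obtain g where g: "arc g" "path_image g = arc_closed e" "pathstart g = arc_start e"
      "pathfinish g = arc_end e"
      using exposed_arcD(10)[OF eE(1)] by blast
    have "path_component K (arc_start e) (arc_end e)"
    proof (rule links_imp[OF E3(3)[rule_format, OF e(1)]])
      show "path_component K (arc_start e) (arc_start e)"
        using E2(2) e(1) by (intro path_component_refl) (auto simp: K_def)
      fix e' assume e': "e' \<in> E3"
      then have "e' \<in> ?E"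
        using E3(1) by (auto simp: E2_def)
      then obtain h where "arc h" "path_image h = arc_closed e'" "pathstart h = arc_start e'"
        "pathfinish h = arc_end e'"
        using exposed_arcD(10) by blast
      then show "path_component K (arc_start e') (arc_end e')"
        unfolding path_component_def using e' arc_imp_path by (intro exI[of _ h]) (auto simp: K_def)
    qed (auto intro: path_component_sym path_component_trans)
    then obtain h0 where h0: "path h0" "path_image h0 \<subseteq> K" "pathstart h0 = arc_start e"
      "pathfinish h0 = arc_end e"
      unfolding path_component_def by blast
    have ne: "arc_start e \<noteq> arc_end e"
      using g arc_distinct_ends by metis
    obtain h where h': "arc h" "path_image h \<subseteq> path_image (reversepath h0)" "pathstart h = arc_end e"
      "pathfinish h = arc_start e"
      by (rule path_contains_arc[of "reversepath h0" "arc_end e" "arc_start e"]) (use h0 ne in auto)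
    then have h: "arc h" "path_image h \<subseteq> K" "pathstart h = arc_end e" "pathfinish h = arc_start e"
      using h0(2) by auto
    have Kfr: "K \<subseteq> frontier (\<Union>T)"
      using E3(1) exposed_arcD(9) unfolding K_def P_def E2_def by blast
    have Kdis: "arc_interior e' \<inter> K = {}" if e': "e' \<in> ?E" "e' \<notin> E3" for e'
    proof -
      have "arc_interior e' \<inter> P = {}"
        using exposed_arcD(4)[OF e'(1)] by (auto simp: P_def)
      moreover have "arc_interior e' \<inter> arc_closed e'' = {}" if "e'' \<in> E3" for e''
        using exposed_arcs_disjoint[OF e'(1), of e''] that e'(2) E3(1) by (auto simp: E2_def)
      ultimately show ?thesis
        unfolding K_def by blast
    qed
    define J where "J = g +++ h"
    have J: "simple_path J" "pathfinish J = pathstart J"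
    proof -
      have "path_image g \<inter> path_image h \<subseteq> {pathstart g, pathstart h}"
      proof -
        have "arc_interior e \<inter> path_image h = {}"
          using Kdis[OF eE(1) e(2)] h(2) by blast
        then show ?thesis
          unfolding g(2,3) h(3) exposed_arcD(6)[OF eE(1)] by blast
      qed
      then show "simple_path J"
        unfolding J_def using g h by (intro simple_path_join_loop) auto
      show "pathfinish J = pathstart J"
        using g h by (simp add: J_def)
    qed
    have Jim: "path_image J = arc_closed e \<union> path_image h"
      using g h by (simp add: J_def path_image_join)
    have Jfr: "path_image J \<subseteq> frontier (\<Union>T)"
      using Jim h(2) Kfr exposed_arcD(9)[OF eE(1)] by blast
    have JE1: "arc_interior e' \<inter> path_image J = {}" if "e' \<in> E1" for e'
    proof -
      have e': "e' \<in> ?E" "e' \<notin> E3" "e' \<noteq> e"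
        using that E1(1) E3(1) eE by (auto simp: E2_def)
      have "arc_interior e' \<inter> arc_closed e = {}"
        using exposed_arcs_disjoint[OF e'(1) eE(1)] e'(3) by blast
      moreover have "arc_interior e' \<inter> path_image h = {}"
        using Kdis[OF e'(1,2)] h(2) by blast
      ultimately show ?thesis
        unfolding Jim by blast
    qed
    define node where "node = case_sum interior (\<lambda>W :: complex set. W)"
    define R where "R u v \<longleftrightarrow> node u \<noteq> {} \<and> node v \<noteq> {} \<and>
      (\<exists>C. connected C \<and> C \<inter> path_image J = {} \<and> node u \<subseteq> C \<and> node v \<subseteq> C)" for u v
    have own: "node (own e') \<noteq> {}" "connected (node (own e'))" "node (own e') \<inter> path_image J = {}"
      if "e' \<in> ?E" for e'
    proof -
      note A = exposed_arcD(1)[OF that]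
      show "node (own e') \<noteq> {}" "connected (node (own e'))"
        using Jordan_region_interior_nonempty[OF Jordan_T[OF A]]
          Jordan_region_connected_interior[OF Jordan_T[OF A]] by (auto simp: node_def own_def)
      have "interior (fst e') \<subseteq> interior (\<Union>T)"
        using A by (intro interior_mono) blast
      then show "node (own e') \<inter> path_image J = {}"
        using Jfr by (auto simp: node_def own_def frontier_def)
    qed
    have "R (own e) (fac e)"
    proof (rule links_imp[OF E1(3)[rule_format, OF eE(1)]])
      show "R (own e) (own e)"
        using own[OF eE(1)] unfolding R_def by blast
    next
      fix e' assume e': "e' \<in> E1"
      then have e'E: "e' \<in> ?E"
        using E1(1) by blast
      obtain q where q: "q \<in> arc_interior e'"
        using exposed_arcD(2)[OF e'E] by blast
      have face: "node (fac e') = arc_face e'" "arc_face e' \<noteq> {}" "connected (arc_face e')"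
        "arc_face e' \<inter> path_image J = {}"
        using arc_face(1)[OF e'E] in_components_nonempty in_components_connected
          in_components_subset Jfr frontier_subset_closed[OF closed_Union_T]
        by (fastforce simp: node_def fac_def)+
      have "q \<in> closure (interior (fst e'))"
        using q exposed_arcD(1,5)[OF e'E] Jordan_region_closure_interior[OF Jordan_T]
          frontier_subset_closed[OF Jordan_region_closed[OF Jordan_T]] by blast
      then have "connected (insert q (interior (fst e')))"
        using own(2)[OF e'E] by (intro connected_insert_closure) (simp_all add: node_def own_def)
      moreover have "q \<in> closure (arc_face e')"
        using q arc_face(2)[OF e'E] by blast
      then have "connected (insert q (arc_face e'))"
        using face(3) by (intro connected_insert_closure)
      ultimately have "connected (insert q (interior (fst e')) \<union> insert q (arc_face e'))"
        by (intro connected_Un) auto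
      moreover have "(insert q (interior (fst e')) \<union> insert q (arc_face e')) \<inter> path_image J = {}"
        using own(3)[OF e'E] face(4) JE1[OF e'] q by (auto simp: node_def own_def)
      moreover have "node (own e') = interior (fst e')"
        by (simp add: node_def own_def)
      ultimately show "R (own e') (fac e')"
        unfolding R_def using own(1)[OF e'E] face(1,2)
        by (intro conjI exI[of _ "insert q (interior (fst e')) \<union> insert q (arc_face e')"]) auto
    next
      fix u v assume "R u v"
      then show "R v u" unfolding R_def by blast
    next
      fix u v w assume "R u v" "R v w"
      then obtain C D where CD: "connected C" "C \<inter> path_image J = {}" "node u \<subseteq> C" "node v \<subseteq> C"
        "connected D" "D \<inter> path_image J = {}" "node v \<subseteq> D" "node w \<subseteq> D"
        "node u \<noteq> {}" "node v \<noteq> {}" "node w \<noteq> {}"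
        unfolding R_def by blast
      have "C \<inter> D \<noteq> {}"
        using CD(4,7,10) by blast
      then have "connected (C \<union> D)"
        using CD(1,5) by (intro connected_Un)
      moreover have "(C \<union> D) \<inter> path_image J = {}" "node u \<subseteq> C \<union> D" "node w \<subseteq> C \<union> D"
        using CD(2,3,6,8) by blast+
      ultimately show "R u w"
        unfolding R_def using CD(9,11) by blast
    qed
    then obtain C where "connected C" "C \<inter> path_image J = {}" "interior (fst e) \<subseteq> C" "arc_face e \<subseteq> C"
      unfolding R_def by (auto simp: node_def own_def fac_def)
    moreover obtain q where q: "q \<in> arc_interior e"
      using exposed_arcD(2)[OF eE(1)] by blast
    moreover have "q \<in> path_image J"
      using q Jim exposed_arcD(6)[OF eE(1)] by blast
    ultimately show False
      using loop_separates_arc_sides[OF eE(1) q J] by blast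
  qed
  then have "card E2 \<le> card P"
    using E3(1,2) by (metis subset_antisym)
  moreover have "card P \<le> card (marks T)"
    using finite_marks by (intro card_mono) (auto simp: P_def)
  moreover have "card ?E = card E1 + card E2"
    using E1(1) fin unfolding E2_def by (metis card_Diff_subset card_mono finite_subset le_add_diff_inverse)
  moreover have "card (T <+> arc_face ` ?E) = card T + card (arc_face ` ?E)"
    using finite_T fin by (simp add: card_Plus)
  ultimately show ?thesis
    using E1(2) by linarith
qed

lemma card_exposed_arcs: "card (exposed_arcs T) \<le> 8 * card T + 2 * card (union_vertices T)"
proof (cases "T = {}")
  case True
  then have "exposed_arcs T = {}"
    by (auto simp: exposed_arcs_def)
  then show ?thesis by simp
next
  case False
  then have "card T \<ge> 1"
    using finite_T by (simp add: Suc_leI card_gt_0_iff)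
  then show ?thesis
    using card_exposed_arcs_aux card_faces card_marks by linarith
qed

end

section \<open>Pairs witnessed by a point of depth two\<close>

definition regions_at :: "complex set set \<Rightarrow> complex \<Rightarrow> complex set set" where
  "regions_at S p = {A \<in> S. p \<in> A}"

definition arc_ends :: "complex set set \<Rightarrow> (complex set \<times> real) set" where
  "arc_ends T = {(A, t). A \<in> T \<and> 0 < t \<and> t \<le> 1 \<and> bd_loop A t \<in> marks T \<and>
      (\<exists>s. 0 \<le> s \<and> s < t \<and> bd_loop A ` {s<..<t} \<subseteq> frontier (\<Union>T))}"

context region_family
begin

lemma arc_ends_subset: "arc_ends T \<subseteq> (\<lambda>(A, s, t). (A, t)) ` exposed_arcs T"
proof
  fix x assume x: "x \<in> arc_ends T"
  obtain A t where xeq: "x = (A, t)" by (cases x)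
  then obtain s where A: "A \<in> T" "0 < t" "t \<le> 1" "bd_loop A t \<in> marks T" "0 \<le> s" "s < t"
    "bd_loop A ` {s<..<t} \<subseteq> frontier (\<Union>T)"
    using x by (auto simp: arc_ends_def)
  let ?M = "insert s {u. 0 \<le> u \<and> u \<le> 1 \<and> bd_loop A u \<in> marks T}"
  have fin: "finite {u \<in> ?M. u < t}"
    using bd_loop_finite_params[OF Jordan_T[OF A(1)] finite_marks] by simp
  define m where "m = Max {u \<in> ?M. u < t}"
  have m: "m \<in> {u \<in> ?M. u < t}"
    unfolding m_def using A(6) by (intro Max_in fin) auto
  have m_max: "v \<le> m" if "v \<in> ?M" "v < t" for v
    unfolding m_def using that by (intro Max_ge fin) simp
  have "s \<le> m"
    using m_max A(6) by simp
  define u where "u = (m + t) / 2"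
  have u: "m < u" "u < t" "s < u" "0 \<le> u" "u \<le> 1"
    using m A \<open>s \<le> m\<close> by (auto simp: u_def)
  have unmarked: "bd_loop A v \<notin> marks T" if "m < v" "v < t" for v
    using m_max[of v] that A(3,5) \<open>s \<le> m\<close> by auto
  have "bd_loop A u \<in> frontier (\<Union>T)"
    using A(7) u by (auto simp: image_subset_iff)
  then obtain s' t' where st: "(A, s', t') \<in> exposed_arcs T" "s' < u" "u < t'"
    using exposed_arc_through[OF A(1) u(4,5)] unmarked[OF u(1,2)] by blast
  then have st': "bd_loop A t' \<in> marks T" "\<And>v. s' < v \<Longrightarrow> v < t' \<Longrightarrow> bd_loop A v \<notin> marks T"
    by (auto simp: exposed_arcs_def image_subset_iff)
  have "\<not> t' < t"
    using unmarked[of t'] st(3) st'(1) u(1) by linarith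
  moreover have "\<not> t < t'"
    using st'(2)[of t] st(2) u(2) A(4) by linarith
  ultimately have "(A, s', t) \<in> exposed_arcs T"
    using st(1) by simp
  then show "x \<in> (\<lambda>(A, s, t). (A, t)) ` exposed_arcs T"
    unfolding xeq by (rule rev_image_eqI) simp
qed

lemma finite_arc_ends: "finite (arc_ends T)"
  using arc_ends_subset finite_exposed_arcs finite_surj by blast

lemma card_arc_ends: "card (arc_ends T) \<le> 8 * card T + 2 * card (union_vertices T)"
  using surj_card_le[OF finite_exposed_arcs arc_ends_subset] card_exposed_arcs by linarith

lemma arc_endI:
  assumes C: "C \<in> T" "0 \<le> s" "s < t" "t \<le> 1"
    and sole: "\<And>u B. s < u \<Longrightarrow> u < t \<Longrightarrow> B \<in> T \<Longrightarrow> bd_loop C u \<in> B \<Longrightarrow> B = C"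
    and stop: "bd_loop C t \<in> {bd_loop C 0, bd_loop C (1/2)} \<or> (\<exists>D\<in>T. D \<noteq> C \<and> bd_loop C t \<in> D)"
  shows "(C, t) \<in> arc_ends T"
proof -
  note J = Jordan_T[OF C(1)]
  have fr: "bd_loop C ` {s<..<t} \<subseteq> frontier (\<Union>T)"
  proof
    fix x assume "x \<in> bd_loop C ` {s<..<t}"
    then obtain u where u: "s < u" "u < t" "x = bd_loop C u" by auto
    show "x \<in> frontier (\<Union>T)"
    proof (rule region_frontier_in_frontier_Union[OF C(1)])
      show "x \<in> frontier C"
        using bd_loop_in_frontier[OF J, of u] u C by simp
      show "x \<notin> B" if "B \<in> T" "B \<noteq> C" for B
        using sole[OF u(1,2) that(1)] that(2) u(3) by blast
    qed
  qed
  have "bd_loop C t \<in> marks T"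
  proof (cases "bd_loop C t \<in> {bd_loop C 0, bd_loop C (1/2)}")
    case True
    then show ?thesis
      using C(1) by (auto simp: marks_def)
  next
    case False
    then obtain D where D: "D \<in> T" "D \<noteq> C" "bd_loop C t \<in> D"
      using stop by blast
    have cont: "continuous_on (closure {s<..<t}) (bd_loop C)"
      using bd_loop_continuous[OF J] by (rule continuous_on_subset) (use C in auto)
    have "bd_loop C ` closure {s<..<t} \<subseteq> frontier (\<Union>T)"
      by (rule image_closure_subset[OF cont frontier_closed fr])
    then have tfr: "bd_loop C t \<in> frontier (\<Union>T)"
      using C(3) by auto
    moreover have "bd_loop C t \<in> frontier C"
      using bd_loop_in_frontier[OF J] C by simp
    moreover have "bd_loop C t \<in> frontier D"
      by (rule frontier_Union_region[OF D(1,3) tfr])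
    ultimately have "bd_loop C t \<in> union_vertices T"
      unfolding union_vertices_def using C(1) D(1,2) by blast
    then show ?thesis
      by (simp add: marks_def)
  qed
  then show ?thesis
    using C fr by (auto simp: arc_ends_def)
qed

end

definition germ :: "complex set set \<Rightarrow> complex set \<Rightarrow> real \<Rightarrow> complex set set \<Rightarrow> bool" where
  "germ S A t \<rho> \<longleftrightarrow> (\<exists>s<t. \<forall>u. s < u \<longrightarrow> u < t \<longrightarrow> regions_at S (bd_loop A u) = \<rho>)"

lemma germ_unique:
  assumes "germ S A t \<rho>" "germ S A t \<rho>'"
  shows "\<rho> = \<rho>'"
proof -
  obtain s s' where s: "s < t" "\<And>u. s < u \<Longrightarrow> u < t \<Longrightarrow> regions_at S (bd_loop A u) = \<rho>"
    "s' < t" "\<And>u. s' < u \<Longrightarrow> u < t \<Longrightarrow> regions_at S (bd_loop A u) = \<rho>'"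
    using assms unfolding germ_def by auto
  define u where "u = (max s s' + t) / 2"
  have "s < u" "s' < u" "u < t"
    using s(1,3) by (auto simp: u_def)
  then show ?thesis
    using s(2,4) by metis
qed

text \<open>A pair \<open>\<pi>\<close> is charged to the end of an exposed arc which determines \<open>\<pi>\<close> and which is present in
  every subfamily that contains \<open>Q\<close> and avoids \<open>Z\<close>.\<close>

definition charged ::
  "complex set set \<Rightarrow> complex set set \<Rightarrow> complex set \<Rightarrow> real \<Rightarrow> complex set set \<Rightarrow> complex set set \<Rightarrow> bool"
  where
  "charged S \<pi> A t Q Z \<longleftrightarrow>
     (germ S A t \<pi> \<or> A \<notin> \<pi> \<and> germ S A t (insert A \<pi>)) \<and>
     Q \<subseteq> S \<and> Z \<subseteq> S \<and> Q \<inter> Z = {} \<and> card Q \<le> 2 \<and> card Z \<le> 2 \<and>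
     (\<forall>T. Q \<subseteq> T \<longrightarrow> T \<subseteq> S - Z \<longrightarrow> (A, t) \<in> arc_ends T)"

lemma charged_determines:
  assumes "charged S \<pi> A t Q Z" "charged S \<pi>' A t Q' Z'" "card \<pi> = 2" "card \<pi>' = 2"
  shows "\<pi> = \<pi>'"
proof -
  have fin: "finite \<pi>" "finite \<pi>'"
    using assms(3,4) by (auto intro: card_ge_0_finite)
  consider "germ S A t \<pi>" "germ S A t \<pi>'"
    | "germ S A t \<pi>" "A \<notin> \<pi>'" "germ S A t (insert A \<pi>')"
    | "A \<notin> \<pi>" "germ S A t (insert A \<pi>)" "germ S A t \<pi>'"
    | "A \<notin> \<pi>" "germ S A t (insert A \<pi>)" "A \<notin> \<pi>'" "germ S A t (insert A \<pi>')"
    using assms(1,2) unfolding charged_def by blast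
  then show ?thesis
  proof cases
    case 1
    then show ?thesis by (rule germ_unique)
  next
    case 2
    then have "\<pi> = insert A \<pi>'"
      using germ_unique by blast
    then show ?thesis
      using assms(3,4) fin 2(2) by simp
  next
    case 3
    then have "\<pi>' = insert A \<pi>"
      using germ_unique by blast
    then show ?thesis
      using assms(3,4) fin 3(1) by simp
  next
    case 4
    then have "insert A \<pi> = insert A \<pi>'"
      using germ_unique by blast
    then show ?thesis
      using 4(1,3) by (simp add: insert_ident)
  qed
qed

definition delaunay :: "complex set set \<Rightarrow> complex set set set" where
  "delaunay S = {\<pi>. card \<pi> = 2 \<and> (\<exists>p. regions_at S p = \<pi>)}"

locale hereditary_family =
  fixes S :: "complex set set"
  assumes finite_S: "finite S"
    and Jordan_S: "A \<in> S \<Longrightarrow> Jordan_region A"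
    and finite_vertices_sub: "T \<subseteq> S \<Longrightarrow> finite (union_vertices T)"
begin

lemma sub_family: "T \<subseteq> S \<Longrightarrow> region_family T"
  using finite_S Jordan_S finite_vertices_sub by unfold_locales (auto intro: finite_subset)

lemma charge_by_walking:
  assumes AB: "A \<noteq> B" and q: "q \<in> frontier A" "regions_at S q = {A, B}"
  shows "(\<exists>v\<in>union_vertices S. regions_at S v = {A, B}) \<or> (\<exists>t Q Z. charged S {A, B} A t Q Z)"
proof -
  have A: "A \<in> S" "B \<in> S"
    using q(2) by (auto simp: regions_at_def)
  interpret S: region_family S
    by (rule sub_family) simp
  note J = Jordan_S[OF A(1)]
  have inA: "bd_loop A u \<in> A" if "0 \<le> u" "u \<le> 1" for u
    using bd_loop_in[OF J] that .
  define good where "good u \<longleftrightarrow> regions_at S (bd_loop A u) = {A, B}" for u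
  define Ob where "Ob = - \<Union>(S - {A, B})"
  have "closed (\<Union>(S - {A, B}))"
    using finite_S Jordan_S Jordan_region_closed by (intro closed_Union) auto
  then have "open Ob"
    by (simp add: Ob_def open_Compl)
  have goodI: "good u" if "0 \<le> u" "u \<le> 1" "bd_loop A u \<in> B" "bd_loop A u \<in> Ob" for u
    using that inA[OF that(1,2)] A by (auto simp: good_def regions_at_def Ob_def)
  have goodD: "bd_loop A u \<in> B" "bd_loop A u \<in> Ob" if "good u" for u
    using that by (auto simp: good_def regions_at_def Ob_def)
  have good_sole: "D = A" if "good u" "D \<in> T" "T \<subseteq> S - {B}" "bd_loop A u \<in> D" for u D T
    using that by (auto simp: good_def regions_at_def)
  have "q \<in> bd_loop A ` {0..1}"
    using q(1) Jordan_region_frontier[OF J] by (simp add: path_image_def)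
  then obtain u0' where u0': "0 \<le> u0'" "u0' \<le> 1" "q = bd_loop A u0'"
    by auto
  define u0 where "u0 = (if u0' = 1 then 0 else u0')"
  have u0: "0 \<le> u0" "u0 < 1" "q = bd_loop A u0"
    using u0' bd_loop(2)[OF J] by (auto simp: u0_def pathstart_def pathfinish_def)
  have good0: "good u0"
    using q(2) u0 by (simp add: good_def)
  have ends: "\<exists>t Q Z. charged S {A, B} A t Q Z"
    if t: "u0 < t" "t \<le> 1" "\<And>u. u0 < u \<Longrightarrow> u < t \<Longrightarrow> good u" and C: "C \<in> S" "C \<noteq> B"
      "bd_loop A t \<in> {bd_loop A 0, bd_loop A (1/2)} \<or> C \<noteq> A \<and> bd_loop A t \<in> C" for t C
  proof -
    have "(A, t) \<in> arc_ends T" if T: "{A, C} \<subseteq> T" "T \<subseteq> S - {B}" for T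
    proof -
      interpret T: region_family T
        using T(2) by (intro sub_family) blast
      show ?thesis
      proof (rule T.arc_endI[OF _ u0(1) t(1,2)])
        show "D = A" if "u0 < u" "u < t" "D \<in> T" "bd_loop A u \<in> D" for u D
          using good_sole[OF t(3)[OF that(1,2)] that(3) T(2) that(4)] .
      qed (use T C in auto)
    qed
    moreover have "germ S A t {A, B}"
      unfolding germ_def using t(1,3) by (intro exI[of _ u0]) (auto simp: good_def)
    moreover have "card {A, C} \<le> 2" "card {B} \<le> 2"
      by (simp_all add: card_insert_if)
    ultimately have "charged S {A, B} A t {A, C} {B}"
      unfolding charged_def using A C AB by blast
    then show ?thesis by blast
  qed
  define Y where "Y = {u. u0 \<le> u \<and> u \<le> 1 \<and> \<not> good u}"
  show ?thesis
  proof (cases "Y = {}")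
    case True
    have "bd_loop A 1 = bd_loop A 0"
      using bd_loop(2)[OF J] by (simp add: pathstart_def pathfinish_def)
    then show ?thesis
      using ends[of 1 A] u0(2) True A AB by (auto simp: Y_def)
  next
    case False
    define t where "t = Inf Y"
    have bdd: "bdd_below Y"
      by (rule bdd_belowI[of _ u0]) (simp add: Y_def)
    have t_le: "t \<le> y" if "y \<in> Y" for y
      unfolding t_def by (rule cInf_lower[OF that bdd])
    have t0: "u0 \<le> t"
      unfolding t_def using False by (rule cInf_greatest) (simp add: Y_def)
    have t1: "t \<le> 1"
      using False t_le by (fastforce simp: Y_def)
    have before: "good u" if "u0 \<le> u" "u < t" for u
      using t_le[of u] that t1 by (auto simp: Y_def)
    have tin: "bd_loop A t \<in> frontier A"
      using bd_loop_in_frontier[OF J] t0 t1 u0 by simp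
    show ?thesis
    proof (cases "good t")
      case True
      have "bd_loop A t \<in> closure (frontier (\<Union>S))"
        unfolding closure_approachable
      proof (intro allI impI)
        fix \<epsilon> :: real assume \<epsilon>: "\<epsilon> > 0"
        have "open (Ob \<inter> ball (bd_loop A t) \<epsilon>)" "bd_loop A t \<in> Ob \<inter> ball (bd_loop A t) \<epsilon>"
          using \<open>open Ob\<close> goodD(2)[OF True] \<epsilon> by auto
        then obtain \<eta> where \<eta>: "\<eta> > 0" "ball (bd_loop A t) \<eta> \<subseteq> Ob \<inter> ball (bd_loop A t) \<epsilon>"
          using openE by blast
        obtain d where d: "d > 0" "\<And>u. u \<in> {0..1} \<Longrightarrow> dist u t < d \<Longrightarrow> dist (bd_loop A u) (bd_loop A t) < \<eta>"
          using bd_loop_continuous[OF J] \<eta>(1) t0 t1 u0(1) unfolding continuous_on_iff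
          by (metis atLeastAtMost_iff order_trans)
        obtain y where y: "y \<in> Y" "y < t + d"
          using cInf_lessD[OF False, of "t + d"] d(1) by (auto simp: t_def)
        have "dist (bd_loop A y) (bd_loop A t) < \<eta>"
          using d(2)[of y] y t_le[OF y(1)] u0(1) by (auto simp: Y_def dist_real_def)
        then have "bd_loop A y \<in> ball (bd_loop A t) \<eta>"
          by (simp add: dist_commute)
        then have "bd_loop A y \<in> Ob \<inter> ball (bd_loop A t) \<epsilon>"
          using \<eta>(2) by blast
        then have yin: "bd_loop A y \<in> Ob" "dist (bd_loop A y) (bd_loop A t) < \<epsilon>"
          by (simp_all add: dist_commute)
        have y01: "0 \<le> y" "y \<le> 1" "\<not> good y"
          using y(1) u0(1) by (auto simp: Y_def)
        have "bd_loop A y \<in> frontier (\<Union>S)"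
        proof (rule S.region_frontier_in_frontier_Union[OF A(1)])
          show "bd_loop A y \<in> frontier A"
            using bd_loop_in_frontier[OF J] y01 by simp
          show "bd_loop A y \<notin> D" if "D \<in> S" "D \<noteq> A" for D
            using that goodI[OF y01(1,2)] y01(3) yin(1) by (auto simp: Ob_def)
        qed
        with yin(2) show "\<exists>x\<in>frontier (\<Union>S). dist x (bd_loop A t) < \<epsilon>" by blast
      qed
      then have tfr: "bd_loop A t \<in> frontier (\<Union>S)"
        by simp
      have "bd_loop A t \<in> frontier B"
        by (rule S.frontier_Union_region[OF A(2) goodD(1)[OF True] tfr])
      then have "bd_loop A t \<in> union_vertices S"
        unfolding union_vertices_def using A AB tin tfr by blast
      then show ?thesis
        using True unfolding good_def by blast
    next
      case False
      then have "t \<noteq> u0"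
        using good0 by blast
      then have ut: "u0 < t"
        using t0 by simp
      have cont: "continuous_on (closure {u0<..<t}) (bd_loop A)"
        using bd_loop_continuous[OF J] by (rule continuous_on_subset) (use ut t1 u0 in auto)
      have "bd_loop A ` {u0<..<t} \<subseteq> B"
        using before goodD(1) by auto
      then have "bd_loop A ` closure {u0<..<t} \<subseteq> B"
        by (rule image_closure_subset[OF cont Jordan_region_closed[OF Jordan_S[OF A(2)]]])
      then have "bd_loop A t \<in> B"
        using ut by auto
      then have "bd_loop A t \<notin> Ob"
        using goodI[of t] False t1 ut u0(1) by auto
      then obtain C where "C \<in> S" "C \<noteq> A" "C \<noteq> B" "bd_loop A t \<in> C"
        by (auto simp: Ob_def)
      then show ?thesis
        using ends[OF ut t1, of C] before by auto
    qed
  qed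
qed

lemma charge_by_face:
  assumes AB: "A \<noteq> B" and p: "regions_at S p = {A, B}"
    and none: "\<And>q. regions_at S q = {A, B} \<Longrightarrow> q \<notin> frontier A \<union> frontier B"
  shows "\<exists>C t Q Z. charged S {A, B} C t Q Z"
proof -
  have A: "A \<in> S" "B \<in> S" "p \<in> A" "p \<in> B"
    using p by (auto simp: regions_at_def)
  note cl = Jordan_region_closed[OF Jordan_S[OF A(1)]] Jordan_region_closed[OF Jordan_S[OF A(2)]]
  define S' where "S' = S - {A, B}"
  interpret S': region_family S'
    by (rule sub_family) (auto simp: S'_def)
  have pS': "p \<in> - \<Union>S'"
    using p by (auto simp: regions_at_def S'_def)
  define W where "W = connected_component_set (- \<Union>S') p"
  have W: "W \<in> components (- \<Union>S')"
    using pS' by (auto simp: W_def components_def)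
  have "p \<in> W"
    using pS' by (simp add: W_def connected_component_refl)
  have WAB: "W \<subseteq> A \<inter> B"
  proof (rule ccontr)
    assume "\<not> W \<subseteq> A \<inter> B"
    then have "W - A \<inter> B \<noteq> {}" "W \<inter> (A \<inter> B) \<noteq> {}"
      using \<open>p \<in> W\<close> A by blast+
    then obtain x where x: "x \<in> W" "x \<in> frontier (A \<inter> B)"
      using connected_Int_frontier[OF in_components_connected[OF W], of "A \<inter> B"] by blast
    have "x \<in> A \<inter> B"
      using x(2) frontier_subset_closed[OF closed_Int[OF cl]] by blast
    moreover have "x \<notin> \<Union>S'"
      using x(1) in_components_subset[OF W] by blast
    ultimately have "regions_at S x = {A, B}"
      using A by (auto simp: regions_at_def S'_def)
    moreover have "x \<in> frontier A \<union> frontier B"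
      using x(2) frontier_Int_subset[of A B] by blast
    ultimately show False
      using none by blast
  qed
  then have "bounded W"
    using Jordan_region_bounded[OF Jordan_S[OF A(1)]] bounded_subset by blast
  then obtain e where e: "e \<in> exposed_arcs S'" "S'.arc_face e = W"
    using S'.bounded_face_arc[OF W _ open_UNIV connected_UNIV _ subset_UNIV] not_bounded_UNIV by blast
  obtain C s t where est: "e = (C, s, t)" by (cases e)
  have C: "C \<in> S'" "0 \<le> s" "s < t" "t \<le> 1" "bd_loop C t \<in> marks S'"
    using e(1) by (auto simp: est exposed_arcs_def)
  have inAB: "bd_loop C u \<in> A \<inter> B" if "s < u" "u < t" for u
  proof -
    have "bd_loop C u \<in> arc_interior e"
      using that by (auto simp: est arc_interior_def)
    then have "bd_loop C u \<in> closure W"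
      using S'.arc_face(2)[OF e(1)] e(2) by blast
    moreover have "closure W \<subseteq> A \<inter> B"
      using WAB cl by (intro closure_minimal) auto
    ultimately show ?thesis by blast
  qed
  have sole: "D = C" if "s < u" "u < t" "D \<in> S'" "bd_loop C u \<in> D" for u D
  proof (rule S'.only_region[of "bd_loop C u"])
    have "bd_loop C u \<in> arc_interior e"
      using that by (auto simp: est arc_interior_def)
    then have "bd_loop C u \<in> frontier (\<Union>S') - marks S'"
      using S'.exposed_arcD(4)[OF e(1)] by blast
    then show "bd_loop C u \<in> frontier (\<Union>S')" "bd_loop C u \<notin> union_vertices S'"
      by (auto simp: marks_def)
    show "bd_loop C u \<in> C"
      using bd_loop_in[OF S'.Jordan_T[OF C(1)], of u] that C by simp
  qed (use that C in auto)
  have "regions_at S (bd_loop C u) = insert C {A, B}" if u: "s < u" "u < t" for u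
  proof -
    have "bd_loop C u \<in> C"
      using bd_loop_in[OF S'.Jordan_T[OF C(1)], of u] u C by simp
    then show ?thesis
      using inAB[OF u] sole[OF u] A C(1) by (auto simp: regions_at_def S'_def)
  qed
  then have germ: "germ S C t (insert C {A, B})"
    unfolding germ_def using C(3) by blast
  obtain D where D: "D \<in> S'"
    "bd_loop C t \<in> {bd_loop C 0, bd_loop C (1/2)} \<or> D \<noteq> C \<and> bd_loop C t \<in> D"
  proof (cases "\<exists>D\<in>S'. D \<noteq> C \<and> bd_loop C t \<in> D")
    case True
    then show thesis
      using that by blast
  next
    case False
    have "bd_loop C t \<notin> union_vertices S'"
    proof
      assume "bd_loop C t \<in> union_vertices S'"
      then obtain D D' where "D \<in> S'" "D' \<in> S'" "D \<noteq> D'" "bd_loop C t \<in> frontier D" "bd_loop C t \<in> frontier D'"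
        by (auto simp: union_vertices_def)
      then have "D \<in> S'" "D' \<in> S'" "D \<noteq> D'" "bd_loop C t \<in> D" "bd_loop C t \<in> D'"
        using frontier_subset_closed[OF Jordan_region_closed[OF S'.Jordan_T]] by blast+
      then show False
        using False by metis
    qed
    then obtain D where D: "D \<in> S'" "bd_loop C t \<in> {bd_loop D 0, bd_loop D (1/2)}"
      using C(5) by (auto simp: marks_def)
    have "bd_loop D 0 \<in> D" "bd_loop D (1/2) \<in> D"
      using bd_loop_in[OF S'.Jordan_T[OF D(1)]] by auto
    then have "bd_loop C t \<in> D"
      using D(2) by auto
    then have "D = C"
      using False D(1) by blast
    then show thesis
      using that D by blast
  qed
  have "(C, t) \<in> arc_ends T" if T: "{C, D} \<subseteq> T" "T \<subseteq> S - {A, B}" for T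
  proof -
    interpret T: region_family T
      using T(2) by (intro sub_family) blast
    show ?thesis
    proof (rule T.arc_endI[OF _ C(2-4)])
      show "E = C" if "s < u" "u < t" "E \<in> T" "bd_loop C u \<in> E" for u E
        using sole[OF that(1,2) _ that(4)] that(3) T(2) by (auto simp: S'_def)
    qed (use T D in auto)
  qed
  moreover have "card {C, D} \<le> 2" "card {A, B} \<le> 2"
    by (simp_all add: card_insert_if)
  moreover have "C \<in> S" "D \<in> S" "C \<notin> {A, B}" "D \<notin> {A, B}"
    using C(1) D(1) by (auto simp: S'_def)
  ultimately have "charged S {A, B} C t {C, D} {A, B}"
    unfolding charged_def using germ A by blast
  then show ?thesis by blast
qed

lemma delaunay_charged:
  assumes "\<pi> \<in> delaunay S"
  shows "\<pi> \<in> regions_at S ` union_vertices S \<or> (\<exists>C t Q Z. charged S \<pi> C t Q Z)"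
proof -
  obtain p where p: "card \<pi> = 2" "regions_at S p = \<pi>"
    using assms by (auto simp: delaunay_def)
  then obtain A B where AB: "\<pi> = {A, B}" "A \<noteq> B"
    by (auto simp: card_2_iff)
  show ?thesis
  proof (cases "\<exists>q. regions_at S q = {A, B} \<and> q \<in> frontier A \<union> frontier B")
    case True
    then obtain q where q: "regions_at S q = {A, B}" "q \<in> frontier A \<or> q \<in> frontier B"
      by blast
    have q': "regions_at S q = {B, A}"
      using q(1) by (simp add: insert_commute)
    have BA: "{B, A} = {A, B}" by blast
    from q(2) show ?thesis
    proof
      assume "q \<in> frontier A"
      from charge_by_walking[OF AB(2) this q(1)] show ?thesis
        unfolding AB(1) by (metis imageI)
    next
      assume "q \<in> frontier B"
      from charge_by_walking[OF AB(2)[symmetric] this q'] show ?thesis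
        unfolding AB(1) BA by (metis imageI)
    qed
  next
    case False
    then have "\<exists>C t Q Z. charged S {A, B} C t Q Z"
      using p(2) AB(1) by (intro charge_by_face[OF AB(2), of p]) auto
    then show ?thesis
      unfolding AB(1) by (rule disjI2)
  qed
qed

end

lemma card_sandwiched_sets:
  assumes "finite U" "Q \<subseteq> U"
  shows "card {T. Q \<subseteq> T \<and> T \<subseteq> U} = 2 ^ (card U - card Q)"
proof -
  have "{T. Q \<subseteq> T \<and> T \<subseteq> U} = (\<lambda>Y. Q \<union> Y) ` Pow (U - Q)"
  proof (intro equalityI subsetI)
    fix T assume "T \<in> {T. Q \<subseteq> T \<and> T \<subseteq> U}"
    then have "T = Q \<union> (T - Q)" "T - Q \<in> Pow (U - Q)" by blast+
    then show "T \<in> (\<lambda>Y. Q \<union> Y) ` Pow (U - Q)" by (rule image_eqI)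
  qed (use assms(2) in auto)
  moreover have "inj_on (\<lambda>Y. Q \<union> Y) (Pow (U - Q))"
    by (rule inj_onI) blast
  moreover have "finite Q"
    using assms finite_subset by blast
  ultimately show ?thesis
    using assms by (simp add: card_image card_Pow card_Diff_subset)
qed

context hereditary_family
begin

lemma card_delaunay:
  assumes M: "\<And>T. T \<subseteq> S \<Longrightarrow> card (arc_ends T) \<le> M"
  shows "card (delaunay S) \<le> card (union_vertices S) + 16 * M"
proof -
  define D where "D = delaunay S - regions_at S ` union_vertices S"
  have D2: "\<pi> \<in> delaunay S" "card \<pi> = 2" if "\<pi> \<in> D" for \<pi>
    using that by (auto simp: D_def delaunay_def)
  have "delaunay S \<subseteq> Pow S"
    by (auto simp: delaunay_def regions_at_def)
  then have finD: "finite D" "finite (delaunay S)"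
    using finite_S by (auto simp: D_def intro: finite_subset)
  have "\<forall>\<pi>\<in>D. \<exists>x. charged S \<pi> (fst x) (fst (snd x)) (fst (snd (snd x))) (snd (snd (snd x)))"
  proof
    fix \<pi> assume "\<pi> \<in> D"
    then obtain C t Q Z where "charged S \<pi> C t Q Z"
      using delaunay_charged[of \<pi>] unfolding D_def by blast
    then show "\<exists>x. charged S \<pi> (fst x) (fst (snd x)) (fst (snd (snd x))) (snd (snd (snd x)))"
      by (intro exI[of _ "(C, t, Q, Z)"]) simp
  qed
  then obtain f where f: "\<And>\<pi>. \<pi> \<in> D \<Longrightarrow>
      charged S \<pi> (fst (f \<pi>)) (fst (snd (f \<pi>))) (fst (snd (snd (f \<pi>)))) (snd (snd (snd (f \<pi>))))"
    by metis
  define g where "g \<pi> = (fst (f \<pi>), fst (snd (f \<pi>)))" for \<pi>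
  define Q where "Q \<pi> = fst (snd (snd (f \<pi>)))" for \<pi>
  define Z where "Z \<pi> = snd (snd (snd (f \<pi>)))" for \<pi>
  have ch: "charged S \<pi> (fst (g \<pi>)) (snd (g \<pi>)) (Q \<pi>) (Z \<pi>)" if "\<pi> \<in> D" for \<pi>
    using f[OF that] by (simp add: g_def Q_def Z_def)
  have inj: "inj_on g D"
  proof (rule inj_onI)
    fix \<pi> \<pi>' assume *: "\<pi> \<in> D" "\<pi>' \<in> D" "g \<pi> = g \<pi>'"
    show "\<pi> = \<pi>'"
      using charged_determines[OF ch[OF *(1)] ch[OF *(2), folded *(3)] D2(2)[OF *(1)] D2(2)[OF *(2)]] .
  qed
  define ok where "ok \<pi> T \<longleftrightarrow> Q \<pi> \<subseteq> T \<and> T \<subseteq> S - Z \<pi>" for \<pi> T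
  have upper: "card {\<pi> \<in> D. ok \<pi> T} \<le> M" if "T \<in> Pow S" for T
  proof -
    have "T \<subseteq> S" using that by simp
    interpret T: region_family T
      by (rule sub_family[OF \<open>T \<subseteq> S\<close>])
    have "g ` {\<pi> \<in> D. ok \<pi> T} \<subseteq> arc_ends T"
    proof
      fix x assume "x \<in> g ` {\<pi> \<in> D. ok \<pi> T}"
      then obtain \<pi> where \<pi>: "\<pi> \<in> D" "ok \<pi> T" "x = g \<pi>" by blast
      then show "x \<in> arc_ends T"
        using ch[OF \<pi>(1)] unfolding charged_def ok_def by simp
    qed
    then have "card {\<pi> \<in> D. ok \<pi> T} \<le> card (arc_ends T)"
      using T.finite_arc_ends inj by (intro card_inj_on_le[of g]) (auto intro: inj_on_subset)
    then show ?thesis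
      using M[OF \<open>T \<subseteq> S\<close>] by linarith
  qed
  have lower: "2 ^ card S \<le> 16 * card {T \<in> Pow S. ok \<pi> T}" if "\<pi> \<in> D" for \<pi>
  proof -
    have *: "Q \<pi> \<subseteq> S" "Z \<pi> \<subseteq> S" "Q \<pi> \<inter> Z \<pi> = {}" "card (Q \<pi>) \<le> 2" "card (Z \<pi>) \<le> 2"
      using ch[OF that] by (auto simp: charged_def)
    have "{T \<in> Pow S. ok \<pi> T} = {T. Q \<pi> \<subseteq> T \<and> T \<subseteq> S - Z \<pi>}"
      by (auto simp: ok_def)
    moreover have "card (S - Z \<pi>) = card S - card (Z \<pi>)"
      using *(2) finite_S by (simp add: card_Diff_subset finite_subset)
    moreover have "Q \<pi> \<subseteq> S - Z \<pi>"
      using *(1,3) by blast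
    ultimately have "card {T \<in> Pow S. ok \<pi> T} = 2 ^ (card S - card (Z \<pi>) - card (Q \<pi>))"
      using card_sandwiched_sets[of "S - Z \<pi>" "Q \<pi>"] finite_S by simp
    moreover have "(2::nat) ^ card S \<le> 2 ^ (4 + (card S - card (Z \<pi>) - card (Q \<pi>)))"
      using *(4,5) by (intro power_increasing) auto
    ultimately show ?thesis
      by (simp add: power_add)
  qed
  have "card D * 2 ^ card S = (\<Sum>\<pi>\<in>D. 2 ^ card S)"
    by simp
  also have "\<dots> \<le> (\<Sum>\<pi>\<in>D. 16 * card {T \<in> Pow S. ok \<pi> T})"
    using lower by (intro sum_mono) auto
  also have "\<dots> = 16 * (\<Sum>\<pi>\<in>D. card {T \<in> Pow S. ok \<pi> T})"
    by (simp add: sum_distrib_left)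
  also have "(\<Sum>\<pi>\<in>D. card {T \<in> Pow S. ok \<pi> T}) = (\<Sum>T\<in>Pow S. card {\<pi> \<in> D. ok \<pi> T})"
  proof -
    have "(\<Sum>\<pi>\<in>D. card {T \<in> Pow S. ok \<pi> T}) = (\<Sum>\<pi>\<in>D. \<Sum>T\<in>Pow S. if ok \<pi> T then 1 else 0)"
      using finite_S by (simp add: sum.If_cases Int_def)
    also have "\<dots> = (\<Sum>T\<in>Pow S. \<Sum>\<pi>\<in>D. if ok \<pi> T then 1 else 0)"
      by (rule sum.swap)
    also have "\<dots> = (\<Sum>T\<in>Pow S. card {\<pi> \<in> D. ok \<pi> T})"
      using finD(1) by (simp add: sum.If_cases Int_def)
    finally show ?thesis .
  qed
  also have "16 * (\<Sum>T\<in>Pow S. card {\<pi> \<in> D. ok \<pi> T}) \<le> 16 * (\<Sum>T\<in>Pow S. M)"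
    using upper by (intro mult_left_mono sum_mono) auto
  also have "\<dots> = 16 * M * 2 ^ card S"
    using finite_S by (simp add: card_Pow)
  finally have "card D \<le> 16 * M"
    by simp
  moreover have "card (regions_at S ` union_vertices S) \<le> card (union_vertices S)"
    using finite_vertices_sub[of S] by (intro card_image_le) simp
  moreover have "card (delaunay S) \<le> card D + card (regions_at S ` union_vertices S)"
  proof -
    have "delaunay S \<subseteq> D \<union> regions_at S ` union_vertices S"
      by (auto simp: D_def)
    then have "card (delaunay S) \<le> card (D \<union> regions_at S ` union_vertices S)"
      using finD finite_vertices_sub[of S] by (intro card_mono) auto
    then show ?thesis
      using card_Un_le le_trans by blast
  qed
  ultimately show ?thesis by linarith
qed

end

section \<open>Shallow pairs\<close>

lemma sum_Bernoulli_weights: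
  fixes q :: real
  assumes "finite S" "Q \<subseteq> S" "Z \<subseteq> S" "Q \<inter> Z = {}"
  shows "(\<Sum>T\<in>Pow S. if Q \<subseteq> T \<and> T \<subseteq> S - Z then q ^ card T * (1 - q) ^ card (S - T) else 0)
    = q ^ card Q * (1 - q) ^ card Z"
proof -
  define f where "f x = (if x \<in> Z then 0 else q)" for x
  define g where "g x = (if x \<in> Q then 0 else 1 - q)" for x
  have "(\<Sum>T\<in>Pow S. if Q \<subseteq> T \<and> T \<subseteq> S - Z then q ^ card T * (1 - q) ^ card (S - T) else 0)
      = (\<Sum>T\<in>Pow S. (\<Prod>x\<in>T. f x) * (\<Prod>x\<in>S-T. g x))"
  proof (rule sum.cong[OF refl])
    fix T assume "T \<in> Pow S"
    then have T: "T \<subseteq> S" "finite T"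
      using assms(1) finite_subset by auto
    show "(if Q \<subseteq> T \<and> T \<subseteq> S - Z then q ^ card T * (1 - q) ^ card (S - T) else 0)
        = (\<Prod>x\<in>T. f x) * (\<Prod>x\<in>S-T. g x)"
    proof (cases "Q \<subseteq> T \<and> T \<subseteq> S - Z")
      case True
      then have "(\<Prod>x\<in>T. f x) = (\<Prod>x\<in>T. q)" "(\<Prod>x\<in>S-T. g x) = (\<Prod>x\<in>S-T. 1 - q)"
        by (intro prod.cong; auto simp: f_def g_def)+
      then show ?thesis
        using True by simp
    next
      case False
      then consider x where "x \<in> Q" "x \<in> S - T" | x where "x \<in> Z" "x \<in> T"
        using assms(2) T(1) by blast
      then have "(\<Prod>x\<in>T. f x) = 0 \<or> (\<Prod>x\<in>S-T. g x) = 0"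
        using T(2) assms(1) by cases (auto simp: f_def g_def)
      then show ?thesis
        using False by auto
    qed
  qed
  also have "\<dots> = (\<Prod>x\<in>S. f x + g x)"
    by (rule prod_add[OF assms(1), symmetric])
  also have "\<dots> = (\<Prod>x\<in>Q \<union> Z. f x + g x)"
    using assms by (intro prod.mono_neutral_right) (auto simp: f_def g_def)
  also have "\<dots> = (\<Prod>x\<in>Q. f x + g x) * (\<Prod>x\<in>Z. f x + g x)"
    using assms finite_subset by (intro prod.union_disjoint) auto
  also have "(\<Prod>x\<in>Q. f x + g x) = (\<Prod>x\<in>Q. q)"
    using assms(4) by (intro prod.cong) (auto simp: f_def g_def)
  also have "(\<Prod>x\<in>Z. f x + g x) = (\<Prod>x\<in>Z. 1 - q)"
    using assms(4) by (intro prod.cong) (auto simp: f_def g_def)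
  finally show ?thesis by simp
qed

lemma expected_card_Bernoulli_subset:
  fixes q :: real
  assumes "finite S"
  shows "(\<Sum>T\<in>Pow S. q ^ card T * (1 - q) ^ card (S - T) * real (card T)) = q * real (card S)"
proof -
  let ?w = "\<lambda>T. q ^ card T * (1 - q) ^ card (S - T)"
  have "(\<Sum>T\<in>Pow S. ?w T * real (card T)) = (\<Sum>T\<in>Pow S. \<Sum>x\<in>S. if x \<in> T then ?w T else 0)"
  proof (rule sum.cong[OF refl])
    fix T assume "T \<in> Pow S"
    then have "S \<inter> T = T" by blast
    then show "?w T * real (card T) = (\<Sum>x\<in>S. if x \<in> T then ?w T else 0)"
      using assms by (simp add: sum.If_cases)
  qed
  also have "\<dots> = (\<Sum>x\<in>S. \<Sum>T\<in>Pow S. if x \<in> T then ?w T else 0)"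
    by (rule sum.swap)
  also have "\<dots> = (\<Sum>x\<in>S. q)"
  proof (rule sum.cong[OF refl])
    fix x assume "x \<in> S"
    have "(\<Sum>T\<in>Pow S. if x \<in> T then ?w T else 0)
        = (\<Sum>T\<in>Pow S. if {x} \<subseteq> T \<and> T \<subseteq> S - {} then ?w T else 0)"
      by (intro sum.cong) auto
    also have "\<dots> = q"
      using sum_Bernoulli_weights[OF assms, of "{x}" "{}" q] \<open>x \<in> S\<close> by simp
    finally show "(\<Sum>T\<in>Pow S. if x \<in> T then ?w T else 0) = q" .
  qed
  finally show ?thesis by simp
qed

definition shallow_pairs :: "nat \<Rightarrow> complex set set \<Rightarrow> complex set set set" where
  "shallow_pairs k S = {\<pi>. card \<pi> = 2 \<and> (\<exists>p. \<pi> \<subseteq> regions_at S p \<and> card (regions_at S p) \<le> k)}"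

lemma finite_shallow_pairs: "finite S \<Longrightarrow> finite (shallow_pairs k S)"
  by (rule finite_subset[of _ "Pow S"]) (auto simp: shallow_pairs_def regions_at_def)

lemma finite_delaunay: "finite S \<Longrightarrow> finite (delaunay S)"
  by (rule finite_subset[of _ "Pow S"]) (auto simp: delaunay_def regions_at_def)

lemma card_shallow_pairs:
  fixes L :: real
  assumes S: "finite S" and k: "k \<ge> 1"
    and L: "\<And>T. T \<subseteq> S \<Longrightarrow> real (card (delaunay T)) \<le> L * real (card T)"
  shows "real (card (shallow_pairs k S)) \<le> 4 * L * real k * real (card S)"
proof -
  define q where "q = 1 / (2 * real k)"
  have q: "0 < q" "q < 1" "real k * q = 1/2"
    using k by (auto simp: q_def field_simps)
  let ?G = "shallow_pairs k S"
  let ?w = "\<lambda>T. q ^ card T * (1 - q) ^ card (S - T)"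
  have w: "?w T \<ge> 0" for T
    using q by simp
  have half: "1/2 \<le> (1 - q) ^ j" if "j \<le> k" for j
  proof -
    have "1/2 = 1 + real k * (- q)"
      using q(3) by simp
    also have "\<dots> \<le> (1 + (- q)) ^ k"
      using q by (intro Bernoulli_inequality) simp
    also have "\<dots> \<le> (1 - q) ^ j"
      using q that by (simp add: power_decreasing)
    finally show ?thesis .
  qed
  have lower: "q\<^sup>2 / 2 \<le> (\<Sum>T\<in>Pow S. if \<pi> \<in> delaunay T then ?w T else 0)" if \<pi>: "\<pi> \<in> ?G" for \<pi>
  proof -
    obtain p where p: "card \<pi> = 2" "\<pi> \<subseteq> regions_at S p" "card (regions_at S p) \<le> k"
      using \<pi> unfolding shallow_pairs_def by blast
    define Z where "Z = regions_at S p - \<pi>"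
    have fin: "finite (regions_at S p)"
      using S by (simp add: regions_at_def)
    have Z: "Z \<subseteq> S" "\<pi> \<subseteq> S" "\<pi> \<inter> Z = {}" "card Z \<le> k"
      using p S card_mono[OF fin, of Z] by (auto simp: Z_def regions_at_def)
    have "q\<^sup>2 / 2 \<le> q ^ card \<pi> * (1 - q) ^ card Z"
      using half[OF Z(4)] p(1) q by simp
    also have "\<dots> = (\<Sum>T\<in>Pow S. if \<pi> \<subseteq> T \<and> T \<subseteq> S - Z then ?w T else 0)"
      using sum_Bernoulli_weights[OF S Z(2,1,3), of q] by simp
    also have "\<dots> \<le> (\<Sum>T\<in>Pow S. if \<pi> \<in> delaunay T then ?w T else 0)"
    proof (rule sum_mono)
      fix T assume "T \<in> Pow S"
      have "\<pi> \<in> delaunay T" if "\<pi> \<subseteq> T" "T \<subseteq> S - Z"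
      proof -
        have "regions_at T p = \<pi>"
          using that p(2) by (auto simp: regions_at_def Z_def)
        then show ?thesis
          using p(1) by (auto simp: delaunay_def)
      qed
      then show "(if \<pi> \<subseteq> T \<and> T \<subseteq> S - Z then ?w T else 0) \<le> (if \<pi> \<in> delaunay T then ?w T else 0)"
        using w[of T] by auto
    qed
    finally show ?thesis .
  qed
  have finG: "finite ?G"
    using S by (rule finite_shallow_pairs)
  have "real (card ?G) * (q\<^sup>2 / 2) = (\<Sum>\<pi>\<in>?G. q\<^sup>2 / 2)"
    by simp
  also have "\<dots> \<le> (\<Sum>\<pi>\<in>?G. \<Sum>T\<in>Pow S. if \<pi> \<in> delaunay T then ?w T else 0)"
    using lower by (rule sum_mono)
  also have "\<dots> = (\<Sum>T\<in>Pow S. \<Sum>\<pi>\<in>?G. if \<pi> \<in> delaunay T then ?w T else 0)"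
    by (rule sum.swap)
  also have "\<dots> \<le> (\<Sum>T\<in>Pow S. ?w T * (L * real (card T)))"
  proof (rule sum_mono)
    fix T assume T: "T \<in> Pow S"
    then have "finite T"
      using S finite_subset by auto
    have "(\<Sum>\<pi>\<in>?G. if \<pi> \<in> delaunay T then ?w T else 0) = ?w T * real (card (?G \<inter> delaunay T))"
      using finG by (simp add: sum.If_cases)
    also have "card (?G \<inter> delaunay T) \<le> card (delaunay T)"
      using finite_delaunay[OF \<open>finite T\<close>] by (intro card_mono) auto
    then have "?w T * real (card (?G \<inter> delaunay T)) \<le> ?w T * real (card (delaunay T))"
      using w[of T] by (intro mult_left_mono) auto
    also have "\<dots> \<le> ?w T * (L * real (card T))"
      using w[of T] L[of T] T by (intro mult_left_mono) auto
    finally show "(\<Sum>\<pi>\<in>?G. if \<pi> \<in> delaunay T then ?w T else 0) \<le> ?w T * (L * real (card T))" .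
  qed
  also have "\<dots> = L * (\<Sum>T\<in>Pow S. ?w T * real (card T))"
    by (simp add: sum_distrib_left algebra_simps)
  also have "\<dots> = L * (q * real (card S))"
    by (simp only: expected_card_Bernoulli_subset[OF S])
  finally have "real (card ?G) * (q\<^sup>2 / 2) \<le> L * (q * real (card S))" .
  then have "q * (real (card ?G) * q) \<le> q * (2 * L * real (card S))"
    by (simp add: power2_eq_square algebra_simps)
  then have "real (card ?G) * q \<le> 2 * L * real (card S)"
    using q(1) by (rule mult_left_le_imp_le)
  then show ?thesis
    using k by (simp add: q_def field_simps)
qed

lemma low_degree_region:
  fixes d :: real
  assumes "finite S" "S \<noteq> {}" and d: "real (card (shallow_pairs k S)) \<le> d * real (card S)"
  shows "\<exists>A\<in>S. real (card {\<pi> \<in> shallow_pairs k S. A \<in> \<pi>}) \<le> 2 * d"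
proof (rule ccontr)
  assume "\<not> ?thesis"
  then have big: "2 * d < real (card {\<pi> \<in> shallow_pairs k S. A \<in> \<pi>})" if "A \<in> S" for A
    using that by (simp add: not_le)
  let ?G = "shallow_pairs k S"
  have finG: "finite ?G"
    using assms(1) by (rule finite_shallow_pairs)
  have "(\<Sum>A\<in>S. 2 * d) < (\<Sum>A\<in>S. real (card {\<pi> \<in> ?G. A \<in> \<pi>}))"
    using assms(1,2) big by (intro sum_strict_mono) auto
  also have "\<dots> = (\<Sum>A\<in>S. \<Sum>\<pi>\<in>?G. if A \<in> \<pi> then 1 else 0)"
    using finG by (simp add: sum.If_cases Int_def)
  also have "\<dots> = (\<Sum>\<pi>\<in>?G. \<Sum>A\<in>S. if A \<in> \<pi> then 1 else 0)"
    by (rule sum.swap)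
  also have "\<dots> = (\<Sum>\<pi>\<in>?G. 2)"
  proof (rule sum.cong[OF refl])
    fix \<pi> assume "\<pi> \<in> ?G"
    then have "S \<inter> \<pi> = \<pi>" "card \<pi> = 2"
      by (auto simp: shallow_pairs_def regions_at_def)
    then show "(\<Sum>A\<in>S. if A \<in> \<pi> then 1 else 0) = (2::real)"
      using assms(1) by (simp add: sum.If_cases)
  qed
  finally show False
    using d by (simp add: mult.commute)
qed

section \<open>Colouring\<close>

lemma colorful_coloring_regions:
  "colorful_coloring (induced_hypergraph S) k \<phi> \<longleftrightarrow>
     (\<forall>p. \<exists>W\<subseteq>regions_at S p. card W = min (card (regions_at S p)) k \<and> inj_on \<phi> W)"
  by (simp add: colorful_coloring_def induced_hypergraph_def regions_at_def)

lemma degenerate_coloring: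
  fixes d :: real
  assumes "finite R" "d < real N"
    and "\<And>S. S \<subseteq> R \<Longrightarrow> real (card (shallow_pairs k S)) \<le> d / 2 * real (card S)"
  shows "\<exists>\<phi>. colorful_coloring (induced_hypergraph R) k \<phi> \<and> \<phi> ` R \<subseteq> {..<N}"
  using assms(1,3)
proof (induction "card R" arbitrary: R)
  case 0
  then have "R = {}" by simp
  then show ?case
    by (simp add: colorful_coloring_regions regions_at_def)
next
  case (Suc m)
  then have "R \<noteq> {}" by auto
  then obtain A where A: "A \<in> R" "real (card {\<pi> \<in> shallow_pairs k R. A \<in> \<pi>}) \<le> d"
    using low_degree_region[OF Suc.prems(1) _ Suc.prems(2)[OF subset_refl]] by (auto simp del: of_nat_le_iff)
  define R0 where "R0 = R - {A}"
  have "m = card R0" "finite R0" "R0 \<subseteq> R"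
    using Suc.hyps(2) Suc.prems(1) A(1) by (auto simp: R0_def)
  then obtain \<phi> where \<phi>: "colorful_coloring (induced_hypergraph R0) k \<phi>" "\<phi> ` R0 \<subseteq> {..<N}"
    using Suc.hyps(1)[of R0] Suc.prems(2) by (meson subset_trans)
  define Nb where "Nb = {B. B \<noteq> A \<and> {A, B} \<in> shallow_pairs k R}"
  have "card Nb \<le> card {\<pi> \<in> shallow_pairs k R. A \<in> \<pi>}"
    using finite_shallow_pairs[OF Suc.prems(1)]
    by (intro card_inj_on_le[of "\<lambda>B. {A, B}"]) (auto simp: Nb_def inj_on_def doubleton_eq_iff)
  then have "card Nb < N"
    using A(2) assms(2) by linarith
  have "Nb \<subseteq> R"
    by (auto simp: Nb_def shallow_pairs_def regions_at_def)
  then have "card (\<phi> ` Nb) \<le> card Nb"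
    using Suc.prems(1) by (intro card_image_le) (auto intro: finite_subset)
  have "\<not> {..<N} \<subseteq> \<phi> ` Nb"
  proof
    assume "{..<N} \<subseteq> \<phi> ` Nb"
    then have "N \<le> card (\<phi> ` Nb)"
      using card_mono[of "\<phi> ` Nb" "{..<N}"] \<open>Nb \<subseteq> R\<close> Suc.prems(1) by (simp add: finite_subset)
    then show False
      using \<open>card (\<phi> ` Nb) \<le> card Nb\<close> \<open>card Nb < N\<close> by linarith
  qed
  then obtain c where c: "c < N" "c \<notin> \<phi> ` Nb" by auto
  define \<psi> where "\<psi> = \<phi>(A := c)"
  have "\<exists>W\<subseteq>regions_at R p. card W = min (card (regions_at R p)) k \<and> inj_on \<psi> W" for p
  proof -
    let ?e = "regions_at R p"
    have fin: "finite ?e"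
      using Suc.prems(1) by (simp add: regions_at_def)
    have e0: "regions_at R0 p = ?e - {A}"
      by (auto simp: regions_at_def R0_def)
    obtain W where W: "W \<subseteq> ?e - {A}" "card W = min (card (?e - {A})) k" "inj_on \<phi> W"
      using \<phi>(1) unfolding colorful_coloring_regions e0[symmetric] by blast
    have \<psi>W: "inj_on \<psi> W"
      using W(1,3) by (auto simp: \<psi>_def inj_on_def)
    show ?thesis
    proof (cases "A \<in> ?e \<and> card ?e \<le> k")
      case False
      then have "card W = min (card ?e) k"
        using W(2) fin by (cases "A \<in> ?e") auto
      then show ?thesis
        using W(1) \<psi>W by blast
    next
      case True
      then have "card W = card (?e - {A})"
        using W(2) card_Diff1_le[of ?e A] by linarith
      then have "W = ?e - {A}"
        using W(1) fin by (intro card_subset_eq) auto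
      moreover have "\<phi> B \<noteq> c" if "B \<in> ?e - {A}" for B
      proof -
        have "card {A, B} = 2" "{A, B} \<subseteq> ?e"
          using that True by (auto simp: card_insert_if)
        then have "{A, B} \<in> shallow_pairs k R"
          using True unfolding shallow_pairs_def by blast
        then have "B \<in> Nb"
          using that by (simp add: Nb_def)
        then show ?thesis
          using c(2) by blast
      qed
      ultimately have "\<psi> A \<notin> \<psi> ` (W - {A})"
        by (auto simp: \<psi>_def)
      with \<psi>W have "inj_on \<psi> (insert A W)"
        by (simp add: inj_on_insert)
      moreover have "insert A W = ?e"
        unfolding \<open>W = ?e - {A}\<close> using True by (simp add: insert_absorb)
      moreover have "card ?e = min (card ?e) k"
        using True by simp
      ultimately show ?thesis
        by (metis subset_refl)
    qed
  qed
  then have "colorful_coloring (induced_hypergraph R) k \<psi>"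
    by (simp add: colorful_coloring_regions)
  moreover have "\<psi> ` R \<subseteq> {..<N}"
    using \<phi>(2) c(1) by (auto simp: \<psi>_def R0_def)
  ultimately show ?case by blast
qed

lemma (in hereditary_family) card_delaunay_linear:
  fixes K :: real
  assumes "1 \<le> K" and V: "\<And>T. T \<subseteq> S \<Longrightarrow> real (card (union_vertices T)) \<le> K * real (card T)"
  shows "real (card (delaunay S)) \<le> 161 * K * real (card S)"
proof -
  let ?m = "real (card S)"
  define M where "M = nat \<lfloor>10 * K * ?m\<rfloor>"
  have "card (arc_ends T) \<le> M" if T: "T \<subseteq> S" for T
  proof -
    interpret T: region_family T
      by (rule sub_family[OF T])
    have "real (card (arc_ends T)) \<le> 8 * real (card T) + 2 * real (card (union_vertices T))"
      using T.card_arc_ends by linarith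
    also have "\<dots> \<le> 8 * (K * real (card T)) + 2 * (K * real (card T))"
      using V[OF T] assms(1) mult_right_mono[of 1 K "real (card T)"] by linarith
    also have "\<dots> = 10 * K * real (card T)"
      by simp
    also have "\<dots> \<le> 10 * K * ?m"
      using assms(1) card_mono[OF finite_S T] by (intro mult_left_mono) auto
    finally show ?thesis
      unfolding M_def by (rule le_nat_floor)
  qed
  then have "card (delaunay S) \<le> card (union_vertices S) + 16 * M"
    by (rule card_delaunay)
  then have "real (card (delaunay S)) \<le> real (card (union_vertices S)) + 16 * real M"
    by linarith
  also have "real M \<le> 10 * K * ?m"
    unfolding M_def using assms(1) by (intro of_nat_floor) simp
  also have "real (card (union_vertices S)) \<le> K * ?m"
    using V by simp
  finally show ?thesis
    by simp
qed

lemma max_union_complexity_bound: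
  assumes "finite R" "T \<subseteq> R" "T \<noteq> {}"
    and b: "ereal_of_enat (max_union_complexity R (card T)) \<le> ereal b"
  shows "finite (union_vertices T)" "real (card (union_vertices T)) \<le> b" "real (card T) \<le> b"
proof -
  let ?F = "{S. S \<subseteq> R \<and> card S \<le> card T}"
  have "finite ?F"
    using assms(1) by (intro finite_subset[of ?F "Pow R"]) auto
  then have "union_complexity T \<le> max_union_complexity R (card T)"
    unfolding max_union_complexity_def using assms(2) by (intro Max_ge) auto
  then have "ereal_of_enat (union_complexity T) \<le> ereal_of_enat (max_union_complexity R (card T))"
    by simp
  then have le: "ereal_of_enat (union_complexity T) \<le> ereal b"
    using b by (rule order_trans)
  show fin: "finite (union_vertices T)"
  proof (rule ccontr)
    assume "infinite (union_vertices T)"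
    then have "union_complexity T = \<infinity>"
      by (simp add: union_complexity_def)
    then show False
      using le by simp
  qed
  have "union_complexity T = enat (max (card T) (card (union_vertices T)))"
    using fin by (simp add: union_complexity_def)
  then have "real (max (card T) (card (union_vertices T))) \<le> b"
    using le by simp
  then show "real (card (union_vertices T)) \<le> b" "real (card T) \<le> b"
    by simp_all
qed

theorem theorem3:
  fixes c \<alpha> :: real
  assumes "0 \<le> \<alpha>" and "\<alpha> \<le> 1"
  shows "\<exists>C>0. \<forall>(k::nat) (n::nat) (R :: complex set set).
           2 \<le> k \<longrightarrow> finite R \<longrightarrow> card R = n \<longrightarrow> (\<forall>A\<in>R. Jordan_region A) \<longrightarrow>
           (\<forall>m. 1 \<le> m \<and> m \<le> n \<longrightarrow>
              ereal_of_enat (max_union_complexity R m) \<le> ereal (c * real m powr (1 + \<alpha>))) \<longrightarrow>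
           real (colorful_number (induced_hypergraph R) k) \<le> C * real k * real n powr \<alpha>"
proof (intro exI[of _ "1289 * max c 1"] conjI allI impI)
  show "0 < 1289 * max c 1" by simp
  fix k n :: nat and R :: "complex set set"
  assume k: "2 \<le> k" and R: "finite R" "card R = n" "\<forall>A\<in>R. Jordan_region A"
    and U: "\<forall>m. 1 \<le> m \<and> m \<le> n \<longrightarrow>
              ereal_of_enat (max_union_complexity R m) \<le> ereal (c * real m powr (1 + \<alpha>))"
  have number_le: "colorful_number (induced_hypergraph R) k \<le> card (\<phi> ` R)"
    if "colorful_coloring (induced_hypergraph R) k \<phi>" for \<phi>
    unfolding colorful_number_def using that by (intro Least_le) (auto simp: induced_hypergraph_def)
  show "real (colorful_number (induced_hypergraph R) k) \<le> 1289 * max c 1 * real k * real n powr \<alpha>"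
  proof (cases "R = {}")
    case True
    then have "colorful_coloring (induced_hypergraph R) k (\<lambda>_. 0)"
      by (simp add: colorful_coloring_regions regions_at_def)
    from number_le[OF this] True show ?thesis
      by simp
  next
    case False
    then have n: "n \<ge> 1"
      using R by (auto simp: Suc_le_eq card_gt_0_iff)
    define K where "K = c * real n powr \<alpha>"
    have bound: "finite (union_vertices T)"
      "real (card (union_vertices T)) \<le> c * real (card T) powr (1 + \<alpha>)"
      "real (card T) \<le> c * real (card T) powr (1 + \<alpha>)" if T: "T \<subseteq> R" "T \<noteq> {}" for T
    proof -
      have "1 \<le> card T" "card T \<le> n"
        using T R(2) card_mono[OF R(1) T(1)] finite_subset[OF T(1) R(1)]
        by (auto simp: Suc_le_eq card_gt_0_iff)
      then have "ereal_of_enat (max_union_complexity R (card T)) \<le> ereal (c * real (card T) powr (1 + \<alpha>))"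
        using U by blast
      from max_union_complexity_bound[OF R(1) T this]
      show "finite (union_vertices T)"
        "real (card (union_vertices T)) \<le> c * real (card T) powr (1 + \<alpha>)"
        "real (card T) \<le> c * real (card T) powr (1 + \<alpha>)" .
    qed
    obtain A where "A \<in> R"
      using False by blast
    then have c: "1 \<le> c"
      using bound(3)[of "{A}"] by simp
    have "1 \<le> real n powr \<alpha>"
      using n assms(1) by (simp add: ge_one_powr_ge_zero)
    then have K: "1 \<le> K"
      unfolding K_def using c mult_mono[of 1 c 1 "real n powr \<alpha>"] by simp
    have V: "real (card (union_vertices T)) \<le> K * real (card T)" and fin: "finite (union_vertices T)"
      if T: "T \<subseteq> R" for T
    proof -
      show "finite (union_vertices T)"
        using bound(1)[OF T] by (cases "T = {}") (auto simp: union_vertices_def)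
      show "real (card (union_vertices T)) \<le> K * real (card T)"
      proof (cases "T = {}")
        case True
        then have "union_vertices T = {}"
          by (simp add: union_vertices_def)
        then show ?thesis
          using True by simp
      next
        case False
        have "card T \<le> n"
          using T R card_mono by blast
        have "real (card (union_vertices T)) \<le> c * real (card T) powr (1 + \<alpha>)"
          using bound(2)[OF T False] .
        also have "\<dots> = c * real (card T) powr \<alpha> * real (card T)"
          by (simp add: powr_add)
        also have "\<dots> \<le> c * real n powr \<alpha> * real (card T)"
          using \<open>card T \<le> n\<close> assms(1) c by (intro mult_right_mono mult_left_mono powr_mono2) auto
        finally show ?thesis
          by (simp add: K_def)
      qed
    qed
    have "real (card (delaunay T)) \<le> 161 * K * real (card T)" if T: "T \<subseteq> R" for T
    proof -
      interpret hereditary_family T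
        using R T fin finite_subset by unfold_locales auto
      show ?thesis
        using V T by (intro card_delaunay_linear[OF K]) blast
    qed
    then have "real (card (shallow_pairs k S)) \<le> 4 * (161 * K) * real k * real (card S)" if "S \<subseteq> R" for S
      using that R(1) k by (intro card_shallow_pairs) (auto intro: finite_subset)
    then have shallow: "real (card (shallow_pairs k S)) \<le> (1288 * K * real k) / 2 * real (card S)"
      if "S \<subseteq> R" for S
      using that by (simp add: mult.assoc)
    define N where "N = Suc (nat \<lfloor>1288 * K * real k\<rfloor>)"
    have nonneg: "0 \<le> 1288 * K * real k"
      using K by simp
    have "1288 * K * real k < real N"
      unfolding N_def using nonneg by linarith
    then obtain \<phi> where \<phi>: "colorful_coloring (induced_hypergraph R) k \<phi>" "\<phi> ` R \<subseteq> {..<N}"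
      using degenerate_coloring[OF R(1) _ shallow] by blast
    have "card (\<phi> ` R) \<le> N"
      using card_mono[OF _ \<phi>(2)] by simp
    then have "real (colorful_number (induced_hypergraph R) k) \<le> real N"
      using number_le[OF \<phi>(1)] by linarith
    also have "real N \<le> 1288 * K * real k + 1"
      unfolding N_def using of_nat_floor[OF nonneg] by simp
    also have "\<dots> \<le> 1288 * K * real k + K * real k"
      using mult_mono[of 1 K 1 "real k"] K k by simp
    also have "\<dots> = 1289 * max c 1 * real k * real n powr \<alpha>"
      using c by (simp add: K_def max_def)
    finally show ?thesis .
  qed
qed

end
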